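(* Let $A\in\mathbb{C}^{n\times n}$ be a negative definite Hermitian matrix and consider the problem (qOMM) $$\min_{X\in\mathcal{OB}(n,p)} E_0(X)=\mathrm{tr}\big((2I-X^*X)\,X^*AX\big).$$ Every local minimizer of qOMM is of the form $X=Q_pV^*$, where $Q_p\in\mathbb{C}^{n\times p}$ consists of (orthonormal) eigenvectors of $A$ corresponding to the $p$ smallest eigenvalues and $V\in\mathbb{C}^{p\times p}$ is a unitary matrix. Conversely, any matrix of the form $Q_pV^*$, with such $Q_p$ and an arbitrary unitary $V\in\mathbb{C}^{p\times p}$, is a local minimizer of qOMM. Furthermore, any local minimum of qOMM is also a global minimum.
   Context: Let $1\le p\le n$ be integers. $X^*$ denotes the conjugate transpose and $I$ an identity matrix of suitable size. The oblique manifold is $\mathcal{OB}(n,p)=\{X\in\mathbb{C}^{n\times p}:\ (X^*X)_{jj}=1 \text{ for } j=1,\dots,p\}$. Local minimizers are understood relative to the constraint set $\mathcal{OB}(n,p)$ (with the topology of the Frobenius norm). Order the eigenvalues of $A$ with multiplicity as $\lambda_1\le\lambda_2\le\dots\le\lambda_n$. "Eigenvectors corresponding to the $p$ smallest eigenvalues" means that $Q_p^*Q_p=I$ and $AQ_p=Q_p\Lambda_p$ with $\Lambda_p=\mathrm{diag}(\lambda_1,\dots,\lambda_p)$; if $\lambda_p=\lambda_{p+1}$ this choice is not unique, and any valid choice of eigenvectors is included. *)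

theory Defs
  imports
    "Jordan_Normal_Form.Schur_Decomposition"
    "HOL-Computational_Algebra.Fundamental_Theorem_Algebra"
begin

definition mat_trace :: "complex mat \<Rightarrow> complex" where
  "mat_trace M = (\<Sum>i<dim_row M. M $$ (i,i))"

definition frobenius_norm :: "complex mat \<Rightarrow> real" where
  "frobenius_norm M = sqrt (\<Sum>i<dim_row M. \<Sum>j<dim_col M. (cmod (M $$ (i,j)))\<^sup>2)"

definition hermitian_mat :: "complex mat \<Rightarrow> bool" where
  "hermitian_mat A \<longleftrightarrow> square_mat A \<and> mat_adjoint A = A"

definition unitary_mat :: "complex mat \<Rightarrow> bool" where
  "unitary_mat V \<longleftrightarrow> square_mat V \<and> mat_adjoint V * V = 1\<^sub>m (dim_row V)
     \<and> V * mat_adjoint V = 1\<^sub>m (dim_row V)"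

text \<open>The form \<open>(A *\<^sub>v v) \<bullet>c v\<close> is $v^* A v$; it is real for Hermitian \<open>A\<close>.\<close>

definition negative_definite_mat :: "complex mat \<Rightarrow> bool" where
  "negative_definite_mat A \<longleftrightarrow> hermitian_mat A \<and>
     (\<forall>v \<in> carrier_vec (dim_row A). v \<noteq> 0\<^sub>v (dim_row A) \<longrightarrow> Re ((A *\<^sub>v v) \<bullet>c v) < 0)"

text \<open>The eigenvalues with multiplicity, in increasing order (indices start at 0). Meant for
  Hermitian matrices, for which \<open>Re\<close> only changes the type; see
  \<open>of_real_sorted_eigenvalues\<close>.\<close>

definition sorted_eigenvalues :: "complex mat \<Rightarrow> real list" where
  "sorted_eigenvalues A = sorted_list_of_multiset (image_mset Re (proots (char_poly A)))"

definition smallest_eigenvectors :: "complex mat \<Rightarrow> nat \<Rightarrow> complex mat \<Rightarrow> bool" where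
  "smallest_eigenvectors A p Q \<longleftrightarrow> Q \<in> carrier_mat (dim_row A) p \<and>
     mat_adjoint Q * Q = 1\<^sub>m p \<and>
     A * Q = Q * mat_diag p (\<lambda>j. complex_of_real (sorted_eigenvalues A ! j))"

definition oblique :: "nat \<Rightarrow> nat \<Rightarrow> complex mat set" where
  "oblique n p = {X \<in> carrier_mat n p. \<forall>j<p. (mat_adjoint X * X) $$ (j,j) = 1}"

text \<open>The trace is real for Hermitian \<open>A\<close> (\<open>of_real_qOMM_energy\<close>), so \<open>Re\<close> only changes the type.\<close>

definition qOMM_energy :: "complex mat \<Rightarrow> complex mat \<Rightarrow> real" where
  "qOMM_energy A X = Re (mat_trace
     ((2 \<cdot>\<^sub>m 1\<^sub>m (dim_col X) - mat_adjoint X * X) * (mat_adjoint X * A * X)))"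

definition local_minimizer :: "(complex mat \<Rightarrow> real) \<Rightarrow> complex mat set \<Rightarrow> complex mat \<Rightarrow> bool" where
  "local_minimizer f S X \<longleftrightarrow> X \<in> S \<and>
     (\<exists>\<epsilon>>0. \<forall>Y\<in>S. frobenius_norm (Y - X) < \<epsilon> \<longrightarrow> f X \<le> f Y)"

definition global_minimizer :: "(complex mat \<Rightarrow> real) \<Rightarrow> complex mat set \<Rightarrow> complex mat \<Rightarrow> bool" where
  "global_minimizer f S X \<longleftrightarrow> X \<in> S \<and> (\<forall>Y\<in>S. f X \<le> f Y)"

lemma mat_adjoint_dim [simp]:
  "dim_row (mat_adjoint A) = dim_col A" "dim_col (mat_adjoint A) = dim_row A"
  by (simp_all add: mat_adjoint_def)

lemma mat_adjoint_carrier [simp]: "A \<in> carrier_mat n m \<Longrightarrow> mat_adjoint A \<in> carrier_mat m n"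
  by (intro carrier_matI) auto

lemma mat_adjoint_index [simp]:
  fixes A :: "complex mat"
  assumes "i < dim_col A" "j < dim_row A"
  shows "mat_adjoint A $$ (i,j) = cnj (A $$ (j,i))"
  using assms by (simp add: mat_adjoint_def mat_of_rows_index)

lemma mat_adjoint_mat_adjoint [simp]: "mat_adjoint (mat_adjoint A) = (A :: complex mat)"
  by (rule eq_matI) auto

lemma mat_adjoint_mult:
  fixes A B :: "complex mat"
  assumes "A \<in> carrier_mat n m" "B \<in> carrier_mat m k"
  shows "mat_adjoint (A * B) = mat_adjoint B * mat_adjoint A"
  by (rule eq_matI) (use assms in \<open>auto simp: scalar_prod_def mult.commute intro!: sum.cong\<close>)

lemma mat_trace_adjoint:
  assumes "M \<in> carrier_mat n n"
  shows "mat_trace (mat_adjoint M) = cnj (mat_trace M)"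
  using assms by (auto simp: mat_trace_def)

lemma mat_trace_comm:
  assumes "A \<in> carrier_mat n m" "B \<in> carrier_mat m n"
  shows "mat_trace (A * B) = mat_trace (B * A)"
proof -
  have "mat_trace (A * B) = (\<Sum>i<n. \<Sum>j<m. A $$ (i,j) * B $$ (j,i))"
    using assms by (simp add: mat_trace_def scalar_prod_def atLeast0LessThan)
  also have "\<dots> = (\<Sum>j<m. \<Sum>i<n. B $$ (j,i) * A $$ (i,j))"
    by (subst sum.swap) (simp add: mult.commute)
  also have "\<dots> = mat_trace (B * A)"
    using assms by (simp add: mat_trace_def scalar_prod_def atLeast0LessThan)
  finally show ?thesis .
qed

lemma of_real_qOMM_energy:
  assumes A: "A \<in> carrier_mat n n" "hermitian_mat A" and X: "X \<in> carrier_mat n p"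
  shows "complex_of_real (qOMM_energy A X) = mat_trace
     ((2 \<cdot>\<^sub>m 1\<^sub>m p - mat_adjoint X * X) * (mat_adjoint X * A * X))"
proof -
  define M where "M = 2 \<cdot>\<^sub>m 1\<^sub>m p - mat_adjoint X * X"
  define N where "N = mat_adjoint X * A * X"
  have c: "M \<in> carrier_mat p p" "N \<in> carrier_mat p p" "mat_adjoint X * A \<in> carrier_mat p n"
    using A X by (auto simp: M_def N_def)
  have XX: "mat_adjoint (mat_adjoint X * X) = mat_adjoint X * X"
    using X by (subst mat_adjoint_mult[of _ p n _ p]) auto
  have M: "mat_adjoint M = M"
  proof (rule eq_matI)
    fix i j assume ij: "i < dim_row M" "j < dim_col M"
    have "cnj ((mat_adjoint X * X) $$ (j,i)) = (mat_adjoint X * X) $$ (i,j)"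
      using ij X c by (subst (2) XX[symmetric]) (simp del: index_mult_mat(1))
    then show "mat_adjoint M $$ (i,j) = M $$ (i,j)"
      using ij X c by (simp add: M_def del: index_mult_mat(1))
  qed (use c in auto)
  have N: "mat_adjoint N = N"
    using A X c unfolding N_def hermitian_mat_def
    by (subst mat_adjoint_mult[of _ p n _ p], simp, simp, subst mat_adjoint_mult[of _ p n _ n])
       (auto intro!: assoc_mult_mat[symmetric])
  have "cnj (mat_trace (M * N)) = mat_trace (mat_adjoint (M * N))"
    using c by (intro mat_trace_adjoint[symmetric, of _ p]) auto
  also have "\<dots> = mat_trace (N * M)"
    using c M N by (subst mat_adjoint_mult[of _ p p _ p]) auto
  also have "\<dots> = mat_trace (M * N)"
    using c by (intro mat_trace_comm) auto
  finally have "mat_trace (M * N) \<in> \<real>"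
    by (simp add: Reals_cnj_iff)
  then show ?thesis
    using X by (simp add: qOMM_energy_def M_def N_def)
qed

lemma length_sorted_eigenvalues:
  assumes "A \<in> carrier_mat n n"
  shows "length (sorted_eigenvalues A) = n"
proof -
  have "length (sorted_eigenvalues A) = size (mset (sorted_eigenvalues A))"
    by (rule size_mset[symmetric])
  then show ?thesis
    using assms degree_monic_char_poly[OF assms]
    by (simp add: sorted_eigenvalues_def size_proots_complex)
qed

lemma hermitian_eigenvalue_real:
  assumes A: "A \<in> carrier_mat n n" "hermitian_mat A" and k: "eigenvalue A k"
  shows "k \<in> \<real>"
proof -
  obtain v where v: "v \<in> carrier_vec n" "v \<noteq> 0\<^sub>v n" "A *\<^sub>v v = k \<cdot>\<^sub>v v"
    using k A by (auto simp: eigenvalue_def eigenvector_def)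
  have eq: "A $$ (j,i) = cnj (A $$ (i,j))" if "i < n" "j < n" for i j
  proof -
    have "A $$ (j,i) = mat_adjoint A $$ (j,i)" using A(2) by (simp add: hermitian_mat_def)
    then show ?thesis using that A(1) by simp
  qed
  define q where "q = (A *\<^sub>v v) \<bullet>c v"
  have q: "q = (\<Sum>i<n. \<Sum>j<n. A $$ (i,j) * v $ j * cnj (v $ i))"
    using A v(1) by (simp add: q_def scalar_prod_def atLeast0LessThan sum_distrib_right)
  have "cnj q = (\<Sum>i<n. \<Sum>j<n. A $$ (j,i) * v $ i * cnj (v $ j))"
    unfolding q by (auto simp: eq[symmetric] mult_ac intro!: sum.cong)
  also have "\<dots> = q" unfolding q by (rule sum.swap)
  finally have "cnj q = q" .
  moreover have q': "q = k * (v \<bullet>c v)" using v by (simp add: q_def)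
  moreover have "cnj (v \<bullet>c v) = v \<bullet>c v"
    using v(1) by (simp add: scalar_prod_def mult.commute)
  moreover have "v \<bullet>c v \<noteq> 0" using v by simp
  ultimately show ?thesis by (simp add: Reals_cnj_iff)
qed

lemma of_real_sorted_eigenvalues:
  assumes A: "A \<in> carrier_mat n n" "hermitian_mat A"
  shows "mset (map complex_of_real (sorted_eigenvalues A)) = proots (char_poly A)"
proof -
  have nz: "char_poly A \<noteq> 0" using degree_monic_char_poly[OF A(1)] by auto
  have "image_mset (\<lambda>x. complex_of_real (Re x)) (proots (char_poly A))
      = image_mset (\<lambda>x. x) (proots (char_poly A))"
    using hermitian_eigenvalue_real[OF A] nz
    by (intro image_mset_cong) (auto simp: eigenvalue_root_char_poly[OF A(1)])
  then show ?thesis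
    by (simp add: sorted_eigenvalues_def multiset.map_comp o_def)
qed

end

theory Submission
  imports Defs
begin

text \<open>With $G = X X^*$ the energy is $\mathrm{tr}(A(2G - G^2))$, and
  \[ E(X + H) - E(X) = 2\,\mathrm{Re}\,\mathrm{tr}(H^* M X) + \mathrm{Re}\,\mathrm{tr}(H^* M H)
       - \mathrm{tr}(A \Delta^2), \qquad M = 2A - GA - AG, \]
  where $\Delta$ is the change of $G$. At a local minimizer, varying one column at a time gives
  $M X = X D$ with $D$ real diagonal. Because $X^*X$ has unit diagonal,
  $\mathrm{tr}((X^*X - I) D) = 0$; expanding this in an eigenbasis of $X^*X$ shows that either
  $X^*X = I$ or there is a unit $w$ with $X w = 0$ and $w^* D w \ge 0$. In the second case a
  perturbation $t z w^*$ with $z$ orthogonal to the range of $X$ lowers the energy at order $t^2$.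
  In the first case $D = 0$, so the range of $X$ is $A$-invariant, and comparing with rotations of
  an eigenvector inside the range towards one outside shows that the range belongs to the $p$
  smallest eigenvalues. Conversely, in an eigenbasis of $A$ the energy is $\sum_i \lambda_i t_i$
  with $t_i \le 1$ and $\sum_{i \in S} t_i \le p$ for every $S$, hence at least
  $\sum_{i \le p} \lambda_i$, the value at $Q_p V^*$.\<close>

text \<open>First order conditions alone cannot suffice: normalised columns may be parallel, and for
  p \<ge> 2 a unit eigenvector of A repeated in every column is stationary. The cure uses p \<le> n:
  loss of rank in X leaves a unit z orthogonal to the range, and there z^* M z = 2 z^* A z < 0,
  which is weighed against w^* D w \<ge> 0. The condition X w = 0 matters because - tr(A \<Delta>^2)
  is nonnegative and could undo the descent if \<Delta> were of first order in t. Local minima are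
  global without any convexity: the classification shows that a local minimizer has the form Q V^*,
  and every matrix of this form already attains the lower bound. Definiteness of A enters three
  times: in the sign of the summands of the trace identity, in z^* A z < 0, and in the lower bound,
  where negative weights t_i can be discarded because all \<lambda>_i are negative.\<close>

section \<open>Matrix algebra with dimension side conditions\<close>

text \<open>This rule and \<open>col_mult2\<close> rewrite the same term to different normal forms.\<close>

declare col_mult [simp del]

lemma mult_mat_assoc_dim:
  fixes A B C :: "'a :: semiring_0 mat"
  assumes "dim_col A = dim_row B" "dim_col B = dim_row C"
  shows "A * B * C = A * (B * C)"
  by (rule assoc_mult_mat[of _ "dim_row A" "dim_row B" _ "dim_row C" _ "dim_col C"])
     (use assms in auto)

lemma mult_mat_vec_assoc_dim:
  fixes A B :: "'a :: semiring_0 mat"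
  assumes "dim_col A = dim_row B" "dim_col B = dim_vec v"
  shows "A * B *\<^sub>v v = A *\<^sub>v (B *\<^sub>v v)"
  by (rule assoc_mult_mat_vec[of _ "dim_row A" "dim_row B" _ "dim_vec v"])
     (use assms in \<open>auto intro: carrier_vecI\<close>)

lemma mat_distrib_dim:
  fixes A B C :: "'a :: ring mat"
  shows "dim_row A = dim_row B \<Longrightarrow> dim_col A = dim_col B \<Longrightarrow> dim_col A = dim_row C \<Longrightarrow>
           (A + B) * C = A * C + B * C"
    and "dim_row A = dim_row B \<Longrightarrow> dim_col A = dim_col B \<Longrightarrow> dim_col A = dim_row C \<Longrightarrow>
           (A - B) * C = A * C - B * C"
    and "dim_row B = dim_row C \<Longrightarrow> dim_col B = dim_col C \<Longrightarrow> dim_col A = dim_row B \<Longrightarrow>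
           A * (B + C) = A * B + A * C"
    and "dim_row B = dim_row C \<Longrightarrow> dim_col B = dim_col C \<Longrightarrow> dim_col A = dim_row B \<Longrightarrow>
           A * (B - C) = A * B - A * C"
  by (rule add_mult_distrib_mat[of _ "dim_row A" "dim_col A" _ _ "dim_col C"]
           minus_mult_distrib_mat[of _ "dim_row A" "dim_col A" _ _ "dim_col C"]
           mult_add_distrib_mat[of _ "dim_row A" "dim_col A" _ "dim_col B"]
           mult_minus_distrib_mat[of _ "dim_row A" "dim_col A" _ "dim_col B"]; auto)+

lemma smult_mult_dim:
  fixes A B :: "'a :: comm_ring mat"
  assumes "dim_col A = dim_row B"
  shows "(k \<cdot>\<^sub>m A) * B = k \<cdot>\<^sub>m (A * B)" and "A * (k \<cdot>\<^sub>m B) = k \<cdot>\<^sub>m (A * B)"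
  by (rule mult_smult_assoc_mat[of _ "dim_row A" "dim_col A" _ "dim_col B"]
        mult_smult_distrib[of _ "dim_row A" "dim_col A" _ "dim_col B"]; use assms in auto)+

lemma mat_adjoint_mult_dim:
  fixes A B :: "complex mat"
  assumes "dim_col A = dim_row B"
  shows "mat_adjoint (A * B) = mat_adjoint B * mat_adjoint A"
  by (rule mat_adjoint_mult[of _ "dim_row A" "dim_col A" _ "dim_col B"]) (use assms in auto)

lemma mat_adjoint_add:
  fixes A B :: "complex mat"
  assumes "dim_row A = dim_row B" "dim_col A = dim_col B"
  shows "mat_adjoint (A + B) = mat_adjoint A + mat_adjoint B"
  by (rule eq_matI) (use assms in auto)

lemma mat_adjoint_minus:
  fixes A B :: "complex mat"
  assumes "dim_row A = dim_row B" "dim_col A = dim_col B"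
  shows "mat_adjoint (A - B) = mat_adjoint A - mat_adjoint B"
  by (rule eq_matI) (use assms in auto)

lemma mat_adjoint_smult: "mat_adjoint (k \<cdot>\<^sub>m A) = cnj k \<cdot>\<^sub>m mat_adjoint (A :: complex mat)"
  by (rule eq_matI) auto

lemma mat_adjoint_mat_diag:
  "mat_adjoint (mat_diag n f :: complex mat) = mat_diag n (\<lambda>i. cnj (f i))"
  by (rule eq_matI) (auto simp: mat_diag_def)

lemma mat_diag_dims [simp]: "dim_row (mat_diag n f) = n" "dim_col (mat_diag n f) = n"
  by (simp_all add: mat_diag_def)

lemma mat_trace_add:
  assumes "dim_row A = dim_row B" "dim_col A = dim_col B" "dim_row B = dim_col B"
  shows "mat_trace (A + B) = mat_trace A + mat_trace B"
  using assms by (simp add: mat_trace_def sum.distrib)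

lemma mat_trace_minus:
  assumes "dim_row A = dim_row B" "dim_col A = dim_col B" "dim_row B = dim_col B"
  shows "mat_trace (A - B) = mat_trace A - mat_trace B"
  using assms by (simp add: mat_trace_def sum_subtractf)

lemma mat_trace_smult:
  assumes "dim_row A = dim_col A"
  shows "mat_trace (k \<cdot>\<^sub>m A) = k * mat_trace A"
  using assms by (simp add: mat_trace_def sum_distrib_left)

lemma mat_trace_comm_dim:
  assumes "dim_col A = dim_row B" "dim_row A = dim_col B"
  shows "mat_trace (A * B) = mat_trace (B * A)"
  by (rule mat_trace_comm[of _ "dim_row A" "dim_row B"]) (use assms in auto)

lemma mat_trace_mat_diag [simp]: "mat_trace (mat_diag n f) = (\<Sum>i<n. f i)"
  by (simp add: mat_trace_def mat_diag_def)

section \<open>Complex inner products and Hermitian forms\<close>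

lemma index_mat_adjoint_mult:
  fixes X Y :: "complex mat"
  assumes "dim_row X = dim_row Y" "i < dim_col X" "j < dim_col Y"
  shows "(mat_adjoint X * Y) $$ (i,j) = col Y j \<bullet>c col X i"
  using assms by (simp add: scalar_prod_def mult.commute)

lemma mult_mat_vec_cscalar_prod:
  fixes A :: "complex mat"
  assumes "dim_col A = dim_vec u" "dim_row A = dim_vec v"
  shows "(A *\<^sub>v u) \<bullet>c v = u \<bullet>c (mat_adjoint A *\<^sub>v v)"
proof -
  have "(A *\<^sub>v u) \<bullet>c v = (\<Sum>i<dim_vec v. \<Sum>j<dim_vec u. A $$ (i,j) * u $ j * cnj (v $ i))"
    using assms by (simp add: scalar_prod_def atLeast0LessThan sum_distrib_right)
  also have "\<dots> = (\<Sum>j<dim_vec u. \<Sum>i<dim_vec v. A $$ (i,j) * u $ j * cnj (v $ i))"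
    by (rule sum.swap)
  also have "\<dots> = u \<bullet>c (mat_adjoint A *\<^sub>v v)"
    using assms by (simp add: scalar_prod_def atLeast0LessThan sum_distrib_left mult_ac)
  finally show ?thesis .
qed

lemma cscalar_prod_cnj:
  fixes u v :: "complex vec"
  assumes "dim_vec u = dim_vec v"
  shows "cnj (u \<bullet>c v) = v \<bullet>c u"
  using assms by (simp add: scalar_prod_def mult.commute)

lemma cscalar_prod_self:
  "(v :: complex vec) \<bullet>c v = complex_of_real (\<Sum>i<dim_vec v. (cmod (v $ i))\<^sup>2)"
  by (simp add: scalar_prod_def atLeast0LessThan complex_norm_square del: of_real_power)

lemma cscalar_prod_self_nonneg: "0 \<le> Re ((v :: complex vec) \<bullet>c v)"
  unfolding cscalar_prod_self by (simp add: sum_nonneg)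

lemma cscalar_prod_self_pos:
  assumes "v \<in> carrier_vec n" "v \<noteq> 0\<^sub>v n"
  shows "0 < Re ((v :: complex vec) \<bullet>c v)"
proof -
  have "v \<bullet>c v \<noteq> 0" using assms by simp
  then have "Re (v \<bullet>c v) \<noteq> 0" by (metis cscalar_prod_self Re_complex_of_real of_real_0)
  then show ?thesis using cscalar_prod_self_nonneg[of v] by linarith
qed

lemma cscalar_prod_of_real_Re: "complex_of_real (Re ((v :: complex vec) \<bullet>c v)) = v \<bullet>c v"
  unfolding cscalar_prod_self by simp

lemma normalise_vec:
  assumes "v \<in> carrier_vec n" "v \<noteq> 0\<^sub>v n"
  obtains a :: real where "0 < a"
    "(complex_of_real a \<cdot>\<^sub>v v) \<bullet>c (complex_of_real a \<cdot>\<^sub>v v) = 1"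
proof -
  define r where "r = Re (v \<bullet>c v)"
  define a where "a = 1 / sqrt r"
  have r: "0 < r" unfolding r_def by (rule cscalar_prod_self_pos[OF assms])
  have "(complex_of_real a \<cdot>\<^sub>v v) \<bullet>c (complex_of_real a \<cdot>\<^sub>v v)
      = complex_of_real a * complex_of_real a * (v \<bullet>c v)"
    unfolding conjugate_smult_vec by simp
  also have "v \<bullet>c v = complex_of_real r"
    unfolding r_def by (rule cscalar_prod_of_real_Re[symmetric])
  also have "complex_of_real a * complex_of_real a * complex_of_real r
      = complex_of_real (a * a * r)" by simp
  also have "a * a * r = 1" using r by (simp add: a_def field_simps)
  finally have "(complex_of_real a \<cdot>\<^sub>v v) \<bullet>c (complex_of_real a \<cdot>\<^sub>v v) = 1" by simp
  moreover have "0 < a" using r by (simp add: a_def)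
  ultimately show ?thesis using that by blast
qed

lemma unit_vec_entry_le:
  fixes v :: "complex vec"
  assumes "v \<bullet>c v = 1" "i < dim_vec v"
  shows "cmod (v $ i) \<le> 1"
proof -
  have s: "(\<Sum>i<dim_vec v. (cmod (v $ i))\<^sup>2) = 1"
    using assms(1) unfolding cscalar_prod_self using of_real_eq_1_iff by blast
  have "(cmod (v $ i))\<^sup>2 \<le> (\<Sum>i<dim_vec v. (cmod (v $ i))\<^sup>2)"
    by (rule member_le_sum) (use assms(2) in auto)
  then have "(cmod (v $ i))\<^sup>2 \<le> 1\<^sup>2" using s by simp
  then show ?thesis by (rule power2_le_imp_le) simp
qed

lemma hermitian_mat_adjoint: "hermitian_mat A \<Longrightarrow> mat_adjoint A = A"
  by (simp add: hermitian_mat_def)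

lemma hermitian_matI: "A \<in> carrier_mat n n \<Longrightarrow> mat_adjoint A = A \<Longrightarrow> hermitian_mat A"
  by (auto simp: hermitian_mat_def square_mat.simps)

lemma hermitian_form_real:
  assumes "hermitian_mat A" "dim_row A = dim_vec v"
  shows "complex_of_real (Re ((A *\<^sub>v v) \<bullet>c v)) = (A *\<^sub>v v) \<bullet>c v"
proof -
  have sq: "dim_col A = dim_vec v" using assms by (simp add: hermitian_mat_def square_mat.simps)
  have "cnj ((A *\<^sub>v v) \<bullet>c v) = v \<bullet>c (A *\<^sub>v v)"
    by (rule cscalar_prod_cnj) (use assms in simp)
  also have "\<dots> = (A *\<^sub>v v) \<bullet>c v"
    using mult_mat_vec_cscalar_prod[of A v v] assms sq by (simp add: hermitian_mat_adjoint)
  finally show ?thesis by (metis Reals_cnj_iff of_real_Re)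
qed

text \<open>Schur triangularization preserves the trace and puts the eigenvalues on the diagonal.
  The lemma serves in contrapositive form: a trace different from n c produces an eigenvalue other
  than c.\<close>

lemma mat_trace_eq_if_single_eigenvalue:
  assumes A: "A \<in> carrier_mat n n" and c: "\<And>k. eigenvalue A k \<Longrightarrow> k = c"
  shows "mat_trace A = of_nat n * c"
proof -
  obtain es where es: "char_poly A = (\<Prod>a\<leftarrow>es. [:- a, 1:])" "length es = n"
    using char_poly_factorized[OF A] by blast
  obtain B P Q where BPQ: "schur_decomposition A es = (B,P,Q)"
    by (cases "schur_decomposition A es") auto
  from schur_decomposition[OF A es(1) BPQ]
  have sim: "similar_mat_wit A B P Q" and diag: "diag_mat B = es" by auto
  from similar_mat_witD2[OF A sim]
  have w: "Q * P = 1\<^sub>m n" "A = P * B * Q" "B \<in> carrier_mat n n" "P \<in> carrier_mat n n"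
    "Q \<in> carrier_mat n n" by auto
  have "mat_trace A = mat_trace (Q * (P * B))"
    unfolding w(2) by (rule mat_trace_comm_dim) (use w in auto)
  also have "Q * (P * B) = B"
    using w by (subst mult_mat_assoc_dim[symmetric]) auto
  also have "mat_trace B = (\<Sum>i<n. B $$ (i,i))" using w by (simp add: mat_trace_def)
  also have "\<dots> = (\<Sum>i<n. c)"
  proof (rule sum.cong)
    fix i assume "i \<in> {..<n}"
    then have "B $$ (i,i) \<in> set es" using w diag by (auto simp: diag_mat_def)
    then have "poly (char_poly A) (B $$ (i,i)) = 0"
      unfolding es(1) poly_prod_list by (auto simp: prod_list_zero_iff image_iff intro!: bexI)
    then show "B $$ (i,i) = c" using c eigenvalue_root_char_poly[OF A] by blast
  qed simp
  finally show ?thesis by simp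
qed

section \<open>Spectral theorem for Hermitian matrices\<close>

lemma mult_mat_diag_iff:
  fixes A Q :: "complex mat"
  assumes "A \<in> carrier_mat n n" "Q \<in> carrier_mat n m"
  shows "A * Q = Q * mat_diag m d \<longleftrightarrow> (\<forall>j<m. A *\<^sub>v col Q j = d j \<cdot>\<^sub>v col Q j)"
proof -
  have "A * Q = Q * mat_diag m d \<longleftrightarrow> (\<forall>j<m. \<forall>i<n. (A * Q) $$ (i,j) = (Q * mat_diag m d) $$ (i,j))"
    using assms by (auto simp: mat_eq_iff simp del: index_mult_mat(1))
  also have "\<dots> \<longleftrightarrow> (\<forall>j<m. \<forall>i<n. (A *\<^sub>v col Q j) $ i = (d j \<cdot>\<^sub>v col Q j) $ i)"
    using assms by (simp add: mat_diag_mult_right[OF assms(2)] mult.commute)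
  also have "\<dots> \<longleftrightarrow> (\<forall>j<m. A *\<^sub>v col Q j = d j \<cdot>\<^sub>v col Q j)"
    using assms by (auto simp: vec_eq_iff simp del: index_mult_mat_vec)
  finally show ?thesis .
qed

lemma orthonormal_cols_iff:
  fixes Q :: "complex mat"
  assumes "Q \<in> carrier_mat n m"
  shows "mat_adjoint Q * Q = 1\<^sub>m m
     \<longleftrightarrow> (\<forall>i<m. \<forall>j<m. col Q j \<bullet>c col Q i = (if i = j then 1 else 0))"
proof -
  have "mat_adjoint Q * Q = 1\<^sub>m m
     \<longleftrightarrow> (\<forall>i<m. \<forall>j<m. (mat_adjoint Q * Q) $$ (i,j) = (1\<^sub>m m :: complex mat) $$ (i,j))"
    using assms by (auto simp: mat_eq_iff simp del: index_mult_mat(1))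
  also have "\<dots> \<longleftrightarrow> (\<forall>i<m. \<forall>j<m. col Q j \<bullet>c col Q i = (if i = j then 1 else 0))"
    using assms by (simp add: index_mat_adjoint_mult del: index_mult_mat(1))
  finally show ?thesis .
qed

text \<open>Deflation: moving the known eigenvalues to a common real value \<open>c\<close> that the trace
  excludes from being the only eigenvalue leaves an eigenvalue \<open>k \<noteq> c\<close>, whose eigenvector is
  orthogonal to the known ones.\<close>

lemma hermitian_new_eigenvector:
  assumes A: "A \<in> carrier_mat n n" "hermitian_mat A" and Q: "Q \<in> carrier_mat n m"
    and QQ: "mat_adjoint Q * Q = 1\<^sub>m m"
    and AQ: "A * Q = Q * mat_diag m (\<lambda>i. complex_of_real (d i))" and mn: "m < n"
  obtains v k where "v \<in> carrier_vec n" "v \<bullet>c v = 1" "mat_adjoint Q *\<^sub>v v = 0\<^sub>v m"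
    "A *\<^sub>v v = complex_of_real k \<cdot>\<^sub>v v"
proof -
  \<comment> \<open>The summand 1 makes the real part of the trace of \<open>B\<close> below equal
    to n c - 1, so \<open>c\<close> cannot be its only eigenvalue.\<close>
  define c where "c = (Re (mat_trace A) - (\<Sum>i<m. d i) + 1) / (real n - real m)"
  define D where "D = mat_diag m (\<lambda>i. complex_of_real (c - d i))"
  define B where "B = A + Q * D * mat_adjoint Q"
  have D: "D \<in> carrier_mat m m" "mat_adjoint D = D"
    by (simp_all add: D_def mat_adjoint_mat_diag)
  have B: "B \<in> carrier_mat n n" using A Q D by (auto simp: B_def)
  have dims: "dim_row A = n" "dim_col A = n" "dim_row Q = n" "dim_col Q = m"
    "dim_row D = m" "dim_col D = m" "dim_row B = n" "dim_col B = n" using A Q B D by auto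
  have hB: "mat_adjoint B = B"
    using A D by (simp add: B_def mat_adjoint_add mat_adjoint_mult_dim dims mult_mat_assoc_dim
        hermitian_mat_adjoint)
  then have herm: "hermitian_mat B" using B by (rule hermitian_matI[rotated])
  have "mat_trace (Q * D * mat_adjoint Q) = mat_trace (mat_adjoint Q * (Q * D))"
    by (rule mat_trace_comm_dim) (simp_all add: dims)
  also have "mat_adjoint Q * (Q * D) = D"
    using D QQ by (subst mult_mat_assoc_dim[symmetric]) (simp_all add: dims)
  finally have trB: "mat_trace B = mat_trace A + mat_trace D"
    by (simp add: B_def mat_trace_add dims)
  have BQ: "B * Q = complex_of_real c \<cdot>\<^sub>m Q"
  proof -
    have "B * Q = A * Q + Q * D"
      using D QQ by (simp add: B_def mat_distrib_dim dims mult_mat_assoc_dim)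
    also have "\<dots> = complex_of_real c \<cdot>\<^sub>m Q"
      unfolding AQ D_def
      by (rule eq_matI) (simp_all add: mat_diag_mult_right[OF Q] dims algebra_simps)
    finally show ?thesis .
  qed
  have "\<exists>k. eigenvalue B k \<and> k \<noteq> complex_of_real c"
  proof (rule ccontr)
    assume "\<not> ?thesis"
    then have "mat_trace B = of_nat n * complex_of_real c"
      by (intro mat_trace_eq_if_single_eigenvalue[OF B]) auto
    then have "Re (mat_trace A) + Re (mat_trace D) = real n * c"
      by (simp add: trB flip: plus_complex.simps(1))
    moreover have "Re (mat_trace D) = real m * c - (\<Sum>i<m. d i)"
      by (simp add: D_def sum_subtractf)
    moreover have "(real n - real m) * c = Re (mat_trace A) - (\<Sum>i<m. d i) + 1"
      using mn by (simp add: c_def)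
    ultimately show False by (simp add: algebra_simps)
  qed
  then obtain k where k: "eigenvalue B k" "k \<noteq> complex_of_real c" by blast
  have "k \<in> \<real>" by (rule hermitian_eigenvalue_real[OF B herm k(1)])
  then obtain k' where k': "k = complex_of_real k'" by (rule Reals_cases)
  obtain u where u: "u \<in> carrier_vec n" "u \<noteq> 0\<^sub>v n" "B *\<^sub>v u = k \<cdot>\<^sub>v u"
    using k(1) B by (auto simp: eigenvalue_def eigenvector_def)
  obtain a :: real where a: "(complex_of_real a \<cdot>\<^sub>v u) \<bullet>c (complex_of_real a \<cdot>\<^sub>v u) = 1"
    using normalise_vec[OF u(1,2)] by blast
  define v where "v = complex_of_real a \<cdot>\<^sub>v u"
  have v: "v \<in> carrier_vec n" using u by (simp add: v_def)
  have Bv: "B *\<^sub>v v = k \<cdot>\<^sub>v v"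
    using u B by (simp add: v_def mult_mat_vec smult_smult_assoc mult.commute)
  \<comment> \<open>Eigenvectors of the Hermitian \<open>B\<close> for distinct eigenvalues are
    orthogonal: evaluating Q^* B v from both sides gives k Q^* v = c Q^* v with k \<noteq>
    c.\<close>
  have orth: "mat_adjoint Q *\<^sub>v v = 0\<^sub>v m"
  proof -
    have "mat_adjoint Q * B = mat_adjoint (B * Q)" by (simp add: mat_adjoint_mult_dim dims hB)
    also have "\<dots> = complex_of_real c \<cdot>\<^sub>m mat_adjoint Q" by (simp add: BQ mat_adjoint_smult)
    finally have QB: "mat_adjoint Q * B = complex_of_real c \<cdot>\<^sub>m mat_adjoint Q" .
    have "k \<cdot>\<^sub>v (mat_adjoint Q *\<^sub>v v) = mat_adjoint Q *\<^sub>v (k \<cdot>\<^sub>v v)"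
      using Q v by (subst mult_mat_vec[of _ m n]) auto
    also have "\<dots> = (mat_adjoint Q * B) *\<^sub>v v"
      using v by (simp add: Bv mult_mat_vec_assoc_dim dims)
    also have "\<dots> = complex_of_real c \<cdot>\<^sub>v (mat_adjoint Q *\<^sub>v v)"
      unfolding QB using v Q by (intro eq_vecI) (auto simp: dims)
    finally have eq: "k \<cdot>\<^sub>v (mat_adjoint Q *\<^sub>v v) = complex_of_real c \<cdot>\<^sub>v (mat_adjoint Q *\<^sub>v v)" .
    show ?thesis
    proof (rule eq_vecI)
      fix i assume "i < dim_vec (0\<^sub>v m :: complex vec)"
      then have i: "i < m" by simp
      have "(k \<cdot>\<^sub>v (mat_adjoint Q *\<^sub>v v)) $ i = (complex_of_real c \<cdot>\<^sub>v (mat_adjoint Q *\<^sub>v v)) $ i"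
        by (simp only: eq)
      then have "k * (mat_adjoint Q *\<^sub>v v) $ i = complex_of_real c * (mat_adjoint Q *\<^sub>v v) $ i"
        using i by (simp add: dims del: index_mult_mat_vec)
      then show "(mat_adjoint Q *\<^sub>v v) $ i = 0\<^sub>v m $ i"
        using k(2) i by (simp del: index_mult_mat_vec)
    qed (simp add: dims)
  qed
  \<comment> \<open>The correction acts through Q^* v = 0, so \<open>B\<close> and \<open>A\<close>
    agree on \<open>v\<close>.\<close>
  have "B *\<^sub>v v = A *\<^sub>v v + Q *\<^sub>v (D *\<^sub>v (mat_adjoint Q *\<^sub>v v))"
  proof -
    have "Q * D * mat_adjoint Q \<in> carrier_mat n n" by (intro carrier_matI) (simp_all add: dims)
    moreover have "dim_vec v = n" using v by simp
    ultimately show ?thesis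
      unfolding B_def
      by (subst add_mult_distrib_mat_vec[OF A(1) _ v]) (simp_all add: mult_mat_vec_assoc_dim dims)
  qed
  also have "\<dots> = A *\<^sub>v v"
  proof -
    have "D *\<^sub>v 0\<^sub>v m = 0\<^sub>v m" using D by (intro eq_vecI) auto
    moreover have "Q *\<^sub>v 0\<^sub>v m = 0\<^sub>v n" using Q by (intro eq_vecI) auto
    ultimately show ?thesis using A v by (simp add: orth)
  qed
  finally have "A *\<^sub>v v = complex_of_real k' \<cdot>\<^sub>v v" using Bv k' by simp
  moreover have "v \<bullet>c v = 1" using a by (simp only: v_def)
  ultimately show ?thesis using that[of v k'] v orth by simp
qed

text \<open>One new eigenvector at a time fills the basis, by induction on n - m. Keeping the given
  columns and values is the point: besides the spectral theorem (m = 0), this completes an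
  eigenbasis of the range of a local minimizer without disturbing it.\<close>

lemma hermitian_extend_eigenbasis:
  assumes A: "A \<in> carrier_mat n n" "hermitian_mat A" and Q: "Q \<in> carrier_mat n m"
    and "mat_adjoint Q * Q = 1\<^sub>m m"
    and "A * Q = Q * mat_diag m (\<lambda>i. complex_of_real (d i))" and "m \<le> n"
  shows "\<exists>U e. U \<in> carrier_mat n n \<and> mat_adjoint U * U = 1\<^sub>m n
    \<and> A * U = U * mat_diag n (\<lambda>i. complex_of_real (e i))
    \<and> (\<forall>j<m. e j = d j \<and> col U j = col Q j)"
  using assms(3-)
proof (induction "n - m" arbitrary: m Q d)
  case 0
  then show ?case by (intro exI[of _ Q] exI[of _ d]) auto
next
  case (Suc l)
  then have mn: "m < n" by simp
  obtain v k where v: "v \<in> carrier_vec n" "v \<bullet>c v = 1" "mat_adjoint Q *\<^sub>v v = 0\<^sub>v m"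
    "A *\<^sub>v v = complex_of_real k \<cdot>\<^sub>v v"
    using hermitian_new_eigenvector[OF A Suc.prems(1-3) mn] by blast
  define R where "R = mat n (Suc m) (\<lambda>(i,j). if j < m then Q $$ (i,j) else v $ i)"
  define e where "e = (\<lambda>j. if j < m then d j else k)"
  have R: "R \<in> carrier_mat n (Suc m)" by (simp add: R_def)
  have colR: "col R j = (if j < m then col Q j else v)" if "j < Suc m" for j
    using that v(1) Suc.prems(1) by (intro eq_vecI) (auto simp: R_def)
  have Qv: "v \<bullet>c col Q i = 0" if "i < m" for i
  proof -
    have "v \<bullet>c col Q i = (mat_adjoint Q *\<^sub>v v) $ i"
      using that v(1) Suc.prems(1) by (auto simp: scalar_prod_def mult.commute)
    then show ?thesis using v(3) that by simp
  qed
  have vQ: "col Q i \<bullet>c v = 0" if "i < m" for i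
    using cscalar_prod_cnj[of v "col Q i"] Qv[OF that] v(1) Suc.prems(1) that by simp
  have 1: "mat_adjoint R * R = 1\<^sub>m (Suc m)"
    unfolding orthonormal_cols_iff[OF R]
    using Suc.prems(2)[unfolded orthonormal_cols_iff[OF Suc.prems(1)]] v(2)
    by (auto simp: colR Qv vQ less_Suc_eq)
  have 2: "A * R = R * mat_diag (Suc m) (\<lambda>i. complex_of_real (e i))"
    unfolding mult_mat_diag_iff[OF A(1) R]
    using Suc.prems(3)[unfolded mult_mat_diag_iff[OF A(1) Suc.prems(1)]] v(4)
    by (auto simp: colR e_def less_Suc_eq)
  obtain U f where U: "U \<in> carrier_mat n n" "mat_adjoint U * U = 1\<^sub>m n"
    "A * U = U * mat_diag n (\<lambda>i. complex_of_real (f i))"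
    "\<forall>j<Suc m. f j = e j \<and> col U j = col R j"
    using Suc.hyps(1)[OF _ R 1 2] Suc.hyps(2) mn by (metis Suc_diff_Suc Suc_leI nat.inject)
  have "\<forall>j<m. f j = d j \<and> col U j = col Q j"
    using U(4) by (auto simp: colR e_def)
  then show ?case using U by blast
qed

text \<open>A unitary eigenbasis makes \<open>A\<close> similar to a diagonal matrix, so its values
  are the roots of the characteristic polynomial with multiplicity. This ties any eigenbasis
  obtained by construction to the list \<open>sorted_eigenvalues A\<close>; only the order is left
  to settle.\<close>

lemma sorted_eigenvalues_eq_sort:
  assumes A: "A \<in> carrier_mat n n" and U: "U \<in> carrier_mat n n" "mat_adjoint U * U = 1\<^sub>m n"
    and AU: "A * U = U * mat_diag n (\<lambda>i. complex_of_real (e i))"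
  shows "sorted_eigenvalues A = sort (map e [0..<n])"
proof -
  let ?D = "mat_diag n (\<lambda>i. complex_of_real (e i))"
  have UU: "U * mat_adjoint U = 1\<^sub>m n"
    by (rule mat_mult_left_right_inverse[OF _ U(1) U(2)]) (use U in simp)
  have "A = A * (U * mat_adjoint U)" using A by (simp add: UU)
  also have "\<dots> = U * ?D * mat_adjoint U"
    using A U AU by (metis assoc_mult_mat mat_adjoint_carrier)
  finally have "A = U * ?D * mat_adjoint U" .
  then have "similar_mat A ?D"
    using A U UU unfolding similar_mat_def
    by (intro exI[of _ U] exI[of _ "mat_adjoint U"] similar_mat_witI[of _ _ n]) auto
  then have "char_poly A = char_poly ?D" by (rule char_poly_similar)
  also have "\<dots> = (\<Prod>a\<leftarrow>diag_mat ?D. [:- a, 1:])"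
    by (rule char_poly_upper_triangular[of _ n]) (auto simp: upper_triangular_def mat_diag_def)
  also have "diag_mat ?D = map (\<lambda>i. complex_of_real (e i)) [0..<n]"
    by (auto simp: diag_mat_def mat_diag_def)
  finally have cp: "char_poly A = (\<Prod>a\<leftarrow>map (\<lambda>i. complex_of_real (e i)) [0..<n]. [:- a, 1:])" .
  have "proots (\<Prod>a\<leftarrow>as. [:- a, 1:]) = mset as" for as :: "complex list"
  proof (induction as)
    case (Cons a as)
    have "(\<Prod>a\<leftarrow>as. [:- a, 1:]) \<noteq> (0 :: complex poly)" by (auto simp: prod_list_zero_iff)
    then have "proots ([:- a, 1:] * (\<Prod>a\<leftarrow>as. [:- a, 1:])) = proots [:- a, 1:] + mset as"
      using Cons by (subst proots_mult) auto
    also have "proots [:- a, 1:] = {#a#}" using proots_linear_factor[of a] by simp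
    finally show ?case by simp
  qed simp
  then have "proots (char_poly A) = mset (map (\<lambda>i. complex_of_real (e i)) [0..<n])"
    unfolding cp .
  then have "image_mset Re (proots (char_poly A)) = mset (map e [0..<n])"
    by (simp add: multiset.map_comp o_def)
  then show ?thesis by (simp only: sorted_eigenvalues_def sorted_list_of_multiset_mset)
qed

lemma sorted_sorted_eigenvalues: "sorted (sorted_eigenvalues A)"
  by (simp add: sorted_eigenvalues_def)

theorem hermitian_sorted_eigenbasis:
  assumes A: "A \<in> carrier_mat n n" "hermitian_mat A"
  obtains U where "U \<in> carrier_mat n n" "mat_adjoint U * U = 1\<^sub>m n"
    "A * U = U * mat_diag n (\<lambda>i. complex_of_real (sorted_eigenvalues A ! i))"
proof -
  have "\<exists>U e. U \<in> carrier_mat n n \<and> mat_adjoint U * U = 1\<^sub>m n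
    \<and> A * U = U * mat_diag n (\<lambda>i. complex_of_real (e i))
    \<and> (\<forall>j<0. e j = (0::real) \<and> col U j = col (0\<^sub>m n 0) j)"
    by (rule hermitian_extend_eigenbasis[OF A]) (use A in \<open>auto intro!: eq_matI\<close>)
  then obtain U e where U: "U \<in> carrier_mat n n" "mat_adjoint U * U = 1\<^sub>m n"
    "A * U = U * mat_diag n (\<lambda>i. complex_of_real (e i))" by blast
  \<comment> \<open>Sorting the indices by their eigenvalue, rather than the values themselves,
    yields the permutation to apply to the columns.\<close>
  define ks where "ks = sort_key e [0..<n]"
  define W where "W = mat n n (\<lambda>(i,j). U $$ (i, ks ! j))"
  have len: "length ks = n" and mem: "set ks = {..<n}" and dist: "distinct ks"
    by (auto simp: ks_def)
  have less: "ks ! j < n" if "j < n" for j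
    using that len mem nth_mem by blast
  have ev: "sorted_eigenvalues A ! j = e (ks ! j)" if "j < n" for j
  proof -
    have "sort (map e [0..<n]) = map e ks"
    proof (rule properties_for_sort)
      show "mset (map e ks) = mset (map e [0..<n])" by (simp only: mset_map ks_def mset_sort)
    qed (simp add: ks_def)
    then show ?thesis using that len by (simp add: sorted_eigenvalues_eq_sort[OF A(1) U])
  qed
  have W: "W \<in> carrier_mat n n" by (simp add: W_def)
  have colW: "col W j = col U (ks ! j)" if "j < n" for j
    using that U(1) less[OF that] by (intro eq_vecI) (auto simp: W_def)
  have "mat_adjoint W * W = 1\<^sub>m n"
    using U(2) unfolding orthonormal_cols_iff[OF W] orthonormal_cols_iff[OF U(1)]
    using less dist len by (simp add: colW nth_eq_iff_index_eq)
  moreover have "A * W = W * mat_diag n (\<lambda>i. complex_of_real (sorted_eigenvalues A ! i))"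
    using U(3) unfolding mult_mat_diag_iff[OF A(1) W] mult_mat_diag_iff[OF A(1) U(1)]
    using less by (simp add: colW ev)
  ultimately show ?thesis using W that by blast
qed

section \<open>Expansion of the energy\<close>

lemma qOMM_energy_eq:
  assumes A: "A \<in> carrier_mat n n" and X: "X \<in> carrier_mat n p"
  shows "qOMM_energy A X = Re (mat_trace
    (A * (2 \<cdot>\<^sub>m (X * mat_adjoint X) - (X * mat_adjoint X) * (X * mat_adjoint X))))"
proof -
  have dims: "dim_row A = n" "dim_col A = n" "dim_row X = n" "dim_col X = p" using A X by auto
  have "mat_trace ((2 \<cdot>\<^sub>m 1\<^sub>m (dim_col X) - mat_adjoint X * X) * (mat_adjoint X * A * X))
      = 2 * mat_trace (mat_adjoint X * A * X)
        - mat_trace (mat_adjoint X * X * (mat_adjoint X * A * X))"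
    by (simp add: mat_distrib_dim smult_mult_dim mat_trace_minus mat_trace_smult dims)
  also have "mat_trace (mat_adjoint X * A * X) = mat_trace (A * (X * mat_adjoint X))"
    by (subst mult_mat_assoc_dim, simp_all add: dims, subst mat_trace_comm_dim)
      (simp_all add: dims mult_mat_assoc_dim)
  also have "mat_trace (mat_adjoint X * X * (mat_adjoint X * A * X))
      = mat_trace ((mat_adjoint X * X * mat_adjoint X) * (A * X))"
    by (simp add: dims mult_mat_assoc_dim)
  also have "\<dots> = mat_trace ((A * X) * (mat_adjoint X * X * mat_adjoint X))"
    by (rule mat_trace_comm_dim) (simp_all add: dims)
  also have "\<dots> = mat_trace (A * (X * mat_adjoint X * (X * mat_adjoint X)))"
    by (simp add: dims mult_mat_assoc_dim)
  finally show ?thesis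
    by (simp add: qOMM_energy_def mat_distrib_dim smult_mult_dim mat_trace_minus mat_trace_smult dims)
qed

text \<open>The Euclidean gradient of the energy at \<open>X\<close> is \<open>2 \<cdot>\<^sub>m (gradient_mat A X * X)\<close>;
  \<open>gram_change X H\<close> is the change of $X X^*$ when \<open>X\<close> moves by \<open>H\<close>.\<close>

definition gradient_mat :: "complex mat \<Rightarrow> complex mat \<Rightarrow> complex mat" where
  "gradient_mat A X = 2 \<cdot>\<^sub>m A - (X * mat_adjoint X) * A - A * (X * mat_adjoint X)"

definition gram_change :: "complex mat \<Rightarrow> complex mat \<Rightarrow> complex mat" where
  "gram_change X H = H * mat_adjoint X + X * mat_adjoint H + H * mat_adjoint H"

lemma gradient_mat_carrier:
  "A \<in> carrier_mat n n \<Longrightarrow> X \<in> carrier_mat n p \<Longrightarrow> gradient_mat A X \<in> carrier_mat n n"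
  by (auto simp: gradient_mat_def)

lemma gradient_mat_adjoint:
  assumes "A \<in> carrier_mat n n" "X \<in> carrier_mat n p" "mat_adjoint A = A"
  shows "mat_adjoint (gradient_mat A X) = gradient_mat A X"
proof -
  have dims: "dim_row A = n" "dim_col A = n" "dim_row X = n" "dim_col X = p" using assms by auto
  show ?thesis
    by (rule eq_matI)
      (simp_all add: gradient_mat_def mat_adjoint_minus mat_adjoint_mult_dim mat_adjoint_smult
        dims assms(3) mult_mat_assoc_dim del: index_mult_mat(1))
qed

text \<open>An identity, not a Taylor estimate: the energy is quadratic in X X^*, so the expansion
  in the change of X X^* stops after two terms. The factor 2 appears because M is Hermitian, which
  makes the two mixed traces complex conjugates.\<close>

lemma qOMM_energy_add:
  assumes A: "A \<in> carrier_mat n n" "mat_adjoint A = A"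
    and X: "X \<in> carrier_mat n p" and H: "H \<in> carrier_mat n p"
  shows "qOMM_energy A (X + H) = qOMM_energy A X
    + 2 * Re (mat_trace (mat_adjoint H * (gradient_mat A X * X)))
    + Re (mat_trace (mat_adjoint H * (gradient_mat A X * H)))
    - Re (mat_trace (A * (gram_change X H * gram_change X H)))"
proof -
  define M where "M = gradient_mat A X"
  define G where "G = X * mat_adjoint X"
  define D where "D = gram_change X H"
  have M: "M \<in> carrier_mat n n" "mat_adjoint M = M"
    using gradient_mat_carrier[OF A(1) X] gradient_mat_adjoint[OF A(1) X A(2)] by (simp_all add: M_def)
  have D: "D \<in> carrier_mat n n" using X H by (auto simp: D_def gram_change_def)
  have dims: "dim_row A = n" "dim_col A = n" "dim_row X = n" "dim_col X = p" "dim_row H = n"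
    "dim_col H = p" "dim_row G = n" "dim_col G = n" "dim_row M = n" "dim_col M = n"
    "dim_row D = n" "dim_col D = n"
    using A X H M D by (auto simp: G_def)
  have GD: "(X + H) * mat_adjoint (X + H) = G + D"
    by (rule eq_matI)
      (simp_all add: G_def D_def gram_change_def mat_adjoint_add mat_distrib_dim dims
        del: index_mult_mat(1))
  have AGD: "mat_trace (A * (D * G)) = mat_trace (G * A * D)"
    using mat_trace_comm_dim[of "A * D" G] by (simp add: dims mult_mat_assoc_dim)
  have "mat_trace (A * (2 \<cdot>\<^sub>m (G + D) - (G + D) * (G + D)))
     = mat_trace (A * (2 \<cdot>\<^sub>m G - G * G))
       + (2 * mat_trace (A * D) - mat_trace (A * (G * D)) - mat_trace (A * (D * G))
          - mat_trace (A * (D * D)))"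
    by (simp add: mat_distrib_dim smult_mult_dim mat_trace_minus mat_trace_add mat_trace_smult dims
        algebra_simps)
  also have "2 * mat_trace (A * D) - mat_trace (A * (G * D)) - mat_trace (A * (D * G))
      = mat_trace (M * D)"
    unfolding AGD
    by (simp add: M_def gradient_mat_def mat_distrib_dim smult_mult_dim mat_trace_minus
        mat_trace_smult dims mult_mat_assoc_dim flip: G_def)
  also have "mat_trace (M * D) = mat_trace (mat_adjoint X * (M * H))
      + mat_trace (mat_adjoint H * (M * X)) + mat_trace (mat_adjoint H * (M * H))"
  proof -
    have "mat_trace (M * D) = mat_trace (M * (H * mat_adjoint X))
        + mat_trace (M * (X * mat_adjoint H)) + mat_trace (M * (H * mat_adjoint H))"
      by (simp add: D_def gram_change_def mat_distrib_dim mat_trace_add dims)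
    moreover have "mat_trace (M * (Y * mat_adjoint Z)) = mat_trace (mat_adjoint Z * (M * Y))"
      if "dim_row Y = n" "dim_row Z = n" "dim_col Y = p" "dim_col Z = p" for Y Z
      using mat_trace_comm_dim[of "M * Y" "mat_adjoint Z"] that
      by (simp add: dims mult_mat_assoc_dim)
    ultimately show ?thesis by (simp add: dims)
  qed
  also have "mat_trace (mat_adjoint X * (M * H)) = cnj (mat_trace (mat_adjoint H * (M * X)))"
  proof -
    have "mat_adjoint X * (M * H) = mat_adjoint (mat_adjoint H * (M * X))"
      by (simp add: mat_adjoint_mult_dim dims M mult_mat_assoc_dim)
    moreover have "mat_adjoint H * (M * X) \<in> carrier_mat p p" by (intro carrier_matI) (simp_all add: dims)
    ultimately show ?thesis by (simp add: mat_trace_adjoint)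
  qed
  finally have *: "mat_trace (A * (2 \<cdot>\<^sub>m (G + D) - (G + D) * (G + D)))
     = mat_trace (A * (2 \<cdot>\<^sub>m G - G * G)) + (cnj (mat_trace (mat_adjoint H * (M * X)))
       + mat_trace (mat_adjoint H * (M * X)) + mat_trace (mat_adjoint H * (M * H))
       - mat_trace (A * (D * D)))" by simp
  have XH: "X + H \<in> carrier_mat n p" using X H by simp
  show ?thesis
    unfolding qOMM_energy_eq[OF A(1) XH] qOMM_energy_eq[OF A(1) X] GD
    unfolding G_def[symmetric] * by (simp flip: M_def D_def)
qed

section \<open>Testing local minimality along curves\<close>

lemma frobenius_norm_le:
  assumes "M \<in> carrier_mat n p" and "\<And>i j. i < n \<Longrightarrow> j < p \<Longrightarrow> cmod (M $$ (i,j)) \<le> c"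
  shows "frobenius_norm M \<le> sqrt (real n * real p) * c"
proof (cases "n = 0 \<or> p = 0")
  case True
  then show ?thesis using assms(1) by (auto simp: frobenius_norm_def)
next
  case False
  then have "cmod (M $$ (0,0)) \<le> c" using assms(2) by simp
  then have c: "0 \<le> c" using norm_ge_zero order_trans by blast
  have "(\<Sum>i<n. \<Sum>j<p. (cmod (M $$ (i,j)))\<^sup>2) \<le> (\<Sum>i<n. \<Sum>j<p. c\<^sup>2)"
    by (intro sum_mono power_mono) (use assms(2) in auto)
  then have "frobenius_norm M \<le> sqrt (real n * real p * c\<^sup>2)"
    using assms(1) by (simp add: frobenius_norm_def mult.assoc)
  then show ?thesis using c by (simp add: real_sqrt_mult)
qed

text \<open>Common end of all descent arguments: \<alpha> is the leading coefficient at order t^k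
  and K t collects the rest. An upper bound on \<open>f\<close> along the curve suffices, so nothing
  has to be differentiated. Taking k = 1 gives a first order test, k = 2 a second order one.\<close>

lemma local_minimizer_curve:
  assumes loc: "local_minimizer f S X" and X: "X \<in> carrier_mat n p"
    and S: "\<And>t. 0 < t \<Longrightarrow> t \<le> 1 \<Longrightarrow> Y t \<in> S"
    and Y: "\<And>t. 0 < t \<Longrightarrow> t \<le> 1 \<Longrightarrow> Y t \<in> carrier_mat n p"
    and close: "\<And>t i j. 0 < t \<Longrightarrow> t \<le> 1 \<Longrightarrow> i < n \<Longrightarrow> j < p \<Longrightarrow>
                  cmod (Y t $$ (i,j) - X $$ (i,j)) \<le> c * t"
    and upper: "\<And>t::real. 0 < t \<Longrightarrow> t \<le> 1 \<Longrightarrow> f (Y t) \<le> f X + t ^ k * (\<alpha> + K * t)"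
  shows "0 \<le> \<alpha>"
proof (rule ccontr)
  assume "\<not> 0 \<le> \<alpha>"
  then have neg: "\<alpha> < 0" by simp
  obtain \<epsilon> where \<epsilon>: "\<epsilon> > 0" "\<And>Y. Y \<in> S \<Longrightarrow> frobenius_norm (Y - X) < \<epsilon> \<Longrightarrow> f X \<le> f Y"
    using loc by (auto simp: local_minimizer_def)
  \<comment> \<open>In \<open>t\<close> the second bound keeps the point within \<epsilon> of
    \<open>X\<close> and the third gives K t \<le> - \<alpha> / 2; the 1 added to \<open>L\<close>
    and to the absolute value of \<open>K\<close> only prevents division by zero.\<close>
  define L where "L = \<bar>sqrt (real n * real p) * c\<bar> + 1"
  define t where "t = min 1 (min (\<epsilon> / (2 * L)) (- \<alpha> / (2 * (\<bar>K\<bar> + 1))))"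
  have L: "L > 0" by (simp add: L_def add_nonneg_pos)
  have t: "0 < t" "t \<le> 1" using neg L \<epsilon>(1) by (auto simp: t_def intro!: divide_pos_pos divide_neg_pos simp del: zero_less_divide_iff)
  have tL: "t * L < \<epsilon>"
  proof -
    have "t \<le> \<epsilon> / (2 * L)" by (simp add: t_def)
    then have "t * L \<le> \<epsilon> / 2" using L by (simp add: field_simps)
    then show ?thesis using \<epsilon>(1) by simp
  qed
  have "Y t - X \<in> carrier_mat n p" using Y[OF t] X by auto
  then have "frobenius_norm (Y t - X) \<le> sqrt (real n * real p) * (c * t)"
    by (rule frobenius_norm_le) (use Y[OF t] X close[OF t] in auto)
  also have "\<dots> \<le> L * t"
    using t abs_ge_self[of "sqrt (real n * real p) * c"]
    by (simp add: L_def mult_right_mono flip: mult.assoc)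
  finally have "f X \<le> f (Y t)" using \<epsilon>(2)[OF S[OF t]] tL by (simp add: mult.commute)
  then have "0 \<le> t ^ k * (\<alpha> + K * t)" using upper[OF t] by linarith
  moreover have "0 < t ^ k" using t by simp
  ultimately have "0 \<le> \<alpha> + K * t" by (simp only: zero_le_mult_iff) linarith
  moreover have "K * t < - \<alpha>"
  proof -
    have "t \<le> - \<alpha> / (2 * (\<bar>K\<bar> + 1))" by (simp add: t_def)
    then have *: "t * (\<bar>K\<bar> + 1) \<le> - \<alpha> / 2" by (simp add: field_simps)
    have "t * K \<le> t * (\<bar>K\<bar> + 1)" using t by (intro mult_left_mono) auto
    then have "K * t \<le> t * (\<bar>K\<bar> + 1)" by (simp only: mult.commute[of K])
    then show ?thesis using * neg by linarith
  qed
  ultimately show False by linarith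
qed

text \<open>The quadratic dependence on the entry bound \<open>c\<close> is what matters: a change
  of X X^* of order t costs t^2, harmless in a first order test, and one of order t^2 costs t^4,
  harmless in a second order test.\<close>

lemma mat_trace_mult_square_bound:
  assumes A: "A \<in> carrier_mat n n" and D: "D \<in> carrier_mat n n"
    and c: "\<And>i j. i < n \<Longrightarrow> j < n \<Longrightarrow> cmod (D $$ (i,j)) \<le> c"
  shows "\<bar>Re (mat_trace (A * (D * D)))\<bar> \<le> (\<Sum>i<n. \<Sum>j<n. cmod (A $$ (i,j))) * real n * c\<^sup>2"
proof -
  have D2: "cmod ((D * D) $$ (i,j)) \<le> real n * c\<^sup>2" if "i < n" "j < n" for i j
  proof -
    have "cmod ((D * D) $$ (i,j)) = cmod (\<Sum>k<n. D $$ (i,k) * D $$ (k,j))"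
      using D that by (simp add: scalar_prod_def atLeast0LessThan)
    also have "\<dots> \<le> (\<Sum>k<n. c * c)"
      by (rule sum_norm_le) (use that in \<open>auto simp: norm_mult intro!: mult_mono' c\<close>)
    finally show ?thesis by (simp add: power2_eq_square)
  qed
  have tr: "mat_trace (A * (D * D)) = (\<Sum>i<n. \<Sum>j<n. A $$ (i,j) * (D * D) $$ (j,i))"
  proof -
    have "(A * E) $$ (i,i) = (\<Sum>j<n. A $$ (i,j) * E $$ (j,i))"
      if "i < n" "E \<in> carrier_mat n n" for i E
      using A that by (simp add: scalar_prod_def atLeast0LessThan)
    then show ?thesis using A D by (simp add: mat_trace_def del: index_mult_mat(1))
  qed
  have "cmod (mat_trace (A * (D * D))) \<le> (\<Sum>i<n. \<Sum>j<n. cmod (A $$ (i,j)) * (real n * c\<^sup>2))"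
    unfolding tr by (intro sum_norm_le) (auto simp: norm_mult simp del: index_mult_mat(1)
        intro!: mult_left_mono D2)
  also have "\<dots> = (\<Sum>i<n. \<Sum>j<n. cmod (A $$ (i,j))) * real n * c\<^sup>2"
    by (simp add: sum_distrib_right mult.assoc)
  finally show ?thesis using abs_Re_le_cmod order_trans by blast
qed

lemma mat_trace_adjoint_mult:
  fixes H N :: "complex mat"
  assumes "H \<in> carrier_mat n p" "N \<in> carrier_mat n p"
  shows "mat_trace (mat_adjoint H * N) = (\<Sum>j<p. col N j \<bullet>c col H j)"
  using assms by (simp add: mat_trace_def index_mat_adjoint_mult del: index_mult_mat(1))

section \<open>First and second order conditions\<close>

lemma cscalar_prod_linear:
  fixes u v w :: "complex vec"
  shows "dim_vec u = dim_vec w \<Longrightarrow> dim_vec v = dim_vec w \<Longrightarrow> (u + v) \<bullet>c w = u \<bullet>c w + v \<bullet>c w"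
    and "dim_vec u = dim_vec w \<Longrightarrow> dim_vec v = dim_vec w \<Longrightarrow> (u - v) \<bullet>c w = u \<bullet>c w - v \<bullet>c w"
    and "dim_vec u = dim_vec w \<Longrightarrow> dim_vec v = dim_vec w \<Longrightarrow> w \<bullet>c (u + v) = w \<bullet>c u + w \<bullet>c v"
    and "dim_vec u = dim_vec w \<Longrightarrow> (k \<cdot>\<^sub>v u) \<bullet>c w = k * (u \<bullet>c w)"
    and "dim_vec u = dim_vec w \<Longrightarrow> w \<bullet>c (k \<cdot>\<^sub>v u) = cnj k * (w \<bullet>c u)"
  by (simp_all add: scalar_prod_def sum.distrib sum_subtractf sum_distrib_left algebra_simps)

lemma oblique_iff:
  "X \<in> oblique n p \<longleftrightarrow> X \<in> carrier_mat n p \<and> (\<forall>j<p. col X j \<bullet>c col X j = 1)"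
  by (auto simp: oblique_def index_mat_adjoint_mult simp del: index_mult_mat(1))

lemma unit_vec_combination:
  fixes x z :: "complex vec"
  assumes "dim_vec x = dim_vec z" "x \<bullet>c x = 1" "z \<bullet>c z = 1" "x \<bullet>c z = 0"
    and "s\<^sup>2 + (cmod c)\<^sup>2 = 1"
  shows "(complex_of_real s \<cdot>\<^sub>v x + c \<cdot>\<^sub>v z) \<bullet>c (complex_of_real s \<cdot>\<^sub>v x + c \<cdot>\<^sub>v z) = 1"
proof -
  have "z \<bullet>c x = 0" using cscalar_prod_cnj[of x z] assms by simp
  then have "(complex_of_real s \<cdot>\<^sub>v x + c \<cdot>\<^sub>v z) \<bullet>c (complex_of_real s \<cdot>\<^sub>v x + c \<cdot>\<^sub>v z)
      = complex_of_real s * complex_of_real s + c * cnj c"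
    using assms by (simp add: cscalar_prod_linear)
  also have "\<dots> = complex_of_real (s\<^sup>2 + (cmod c)\<^sup>2)"
    using complex_norm_square[of c] by (simp add: power2_eq_square)
  finally show ?thesis using assms by simp
qed

text \<open>On the unit interval 1 - y lies above its square, hence below its square root. With y =
  t^2 this shows that renormalising a column costs only second order in t.\<close>

lemma abs_sqrt_one_minus_le:
  fixes y :: real
  assumes "0 \<le> y" "y \<le> 1"
  shows "\<bar>sqrt (1 - y) - 1\<bar> \<le> y"
proof -
  have "(1 - y)\<^sup>2 \<le> 1 - y"
    using assms by (simp add: power2_eq_square mult_left_le_one_le)
  then have "1 - y \<le> sqrt (1 - y)" using assms real_le_rsqrt by blast
  moreover have "sqrt (1 - y) \<le> 1" using assms by simp
  ultimately show ?thesis by linarith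
qed

lemma mult_adjoint_entry_bound:
  fixes P Q :: "complex mat"
  assumes "P \<in> carrier_mat n p" "Q \<in> carrier_mat m p" "i < n" "k < m" "0 \<le> a"
    and "\<And>j. j < p \<Longrightarrow> cmod (P $$ (i,j)) \<le> a" and "\<And>j. j < p \<Longrightarrow> cmod (Q $$ (k,j)) \<le> b"
  shows "cmod ((P * mat_adjoint Q) $$ (i,k)) \<le> real p * (a * b)"
proof -
  have "cmod ((P * mat_adjoint Q) $$ (i,k)) = cmod (\<Sum>j<p. P $$ (i,j) * cnj (Q $$ (k,j)))"
    using assms by (simp add: scalar_prod_def atLeast0LessThan)
  also have "\<dots> \<le> (\<Sum>j<p. a * b)"
    by (rule sum_norm_le) (use assms in \<open>auto simp: norm_mult intro!: mult_mono\<close>)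
  finally show ?thesis by simp
qed

lemma hermitian_form_bound:
  fixes M :: "complex mat"
  assumes M: "M \<in> carrier_mat n n" and h: "h \<in> carrier_vec n"
    and c: "\<And>i. i < n \<Longrightarrow> cmod (h $ i) \<le> c"
  shows "\<bar>Re ((M *\<^sub>v h) \<bullet>c h)\<bar> \<le> (\<Sum>i<n. \<Sum>j<n. cmod (M $$ (i,j))) * c\<^sup>2"
proof -
  have "(M *\<^sub>v h) \<bullet>c h = (\<Sum>i<n. \<Sum>j<n. M $$ (i,j) * h $ j * cnj (h $ i))"
    using M h by (simp add: scalar_prod_def atLeast0LessThan sum_distrib_right)
  also have "cmod \<dots> \<le> (\<Sum>i<n. \<Sum>j<n. cmod (M $$ (i,j)) * c\<^sup>2)"
    by (intro sum_norm_le)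
      (auto simp: norm_mult mult.assoc power2_eq_square intro!: mult_left_mono mult_mono' c)
  also have "\<dots> = (\<Sum>i<n. \<Sum>j<n. cmod (M $$ (i,j))) * c\<^sup>2"
    by (simp add: sum_distrib_right)
  finally show ?thesis using abs_Re_le_cmod order_trans by blast
qed

lemma oblique_entry_le:
  assumes "X \<in> oblique n p" "i < n" "j < p"
  shows "cmod (X $$ (i,j)) \<le> 1"
  using unit_vec_entry_le[of "col X j" i] assms by (auto simp: oblique_iff)

text \<open>Replacing the single column x by sqrt(1 - t^2) x + t v, with a unit v orthogonal to x,
  stays feasible. If M x had a component r orthogonal to x, the direction v = - a r would lower the
  energy to first order.\<close>

lemma local_minimizer_gradient_eigenvector:
  assumes A: "A \<in> carrier_mat n n" "mat_adjoint A = A"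
    and loc: "local_minimizer (qOMM_energy A) (oblique n p) X" and j: "j < p"
  defines "M \<equiv> gradient_mat A X" and "x \<equiv> col X j"
  shows "M *\<^sub>v x = complex_of_real (Re ((M *\<^sub>v x) \<bullet>c x)) \<cdot>\<^sub>v x"
proof (rule ccontr)
  assume neq: "\<not> ?thesis"
  have ob: "X \<in> oblique n p" using loc by (simp add: local_minimizer_def)
  then have X: "X \<in> carrier_mat n p" and cols: "\<And>k. k < p \<Longrightarrow> col X k \<bullet>c col X k = 1"
    by (auto simp: oblique_iff)
  have M: "M \<in> carrier_mat n n" "mat_adjoint M = M"
    unfolding M_def by (rule gradient_mat_carrier[OF A(1) X] gradient_mat_adjoint[OF A(1) X A(2)])+
  have x: "x \<in> carrier_vec n" "x \<bullet>c x = 1" using X j cols by (auto simp: x_def)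
  define d where "d = Re ((M *\<^sub>v x) \<bullet>c x)"
  define r where "r = M *\<^sub>v x - complex_of_real d \<cdot>\<^sub>v x"
  have r: "r \<in> carrier_vec n" using M x by (simp add: r_def)
  have Mx: "M *\<^sub>v x \<in> carrier_vec n" using M x by simp
  have d: "complex_of_real d = (M *\<^sub>v x) \<bullet>c x"
    unfolding d_def
    by (rule hermitian_form_real[OF hermitian_matI[OF M]]) (use M(1) x(1) in auto)
  have rx: "r \<bullet>c x = 0" using M x d by (simp add: r_def cscalar_prod_linear)
  have xr: "x \<bullet>c r = 0" using cscalar_prod_cnj[of r x] rx r x by simp
  have Mx_eq: "M *\<^sub>v x = r + complex_of_real d \<cdot>\<^sub>v x"
    using M(1) x(1) by (intro eq_vecI) (auto simp: r_def)
  have "r \<noteq> 0\<^sub>v n"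
  proof
    assume "r = 0\<^sub>v n"
    then have "M *\<^sub>v x = complex_of_real d \<cdot>\<^sub>v x"
      unfolding Mx_eq using x(1) left_zero_vec[of "complex_of_real d \<cdot>\<^sub>v x" n] by simp
    then show False using neq by (simp only: d_def)
  qed
  define \<rho> where "\<rho> = Re (r \<bullet>c r)"
  have \<rho>: "0 < \<rho>" unfolding \<rho>_def by (rule cscalar_prod_self_pos[OF r \<open>r \<noteq> 0\<^sub>v n\<close>])
  obtain a :: real where a: "0 < a"
    and ar: "(complex_of_real a \<cdot>\<^sub>v r) \<bullet>c (complex_of_real a \<cdot>\<^sub>v r) = 1"
    using normalise_vec[OF r \<open>r \<noteq> 0\<^sub>v n\<close>] by blast
  define v where "v = complex_of_real (- a) \<cdot>\<^sub>v r"
  have v: "v \<in> carrier_vec n" using r by (simp add: v_def)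
  have vv: "v \<bullet>c v = 1" using ar r by (simp add: v_def cscalar_prod_linear)
  have xv: "x \<bullet>c v = 0" using xr r x by (simp add: v_def cscalar_prod_linear)
  have Mxv: "Re ((M *\<^sub>v x) \<bullet>c v) = - a * \<rho>"
    using r x xr by (simp add: Mx_eq v_def cscalar_prod_linear \<rho>_def)
  define h where "h = (\<lambda>t. complex_of_real (sqrt (1 - t\<^sup>2) - 1) \<cdot>\<^sub>v x + complex_of_real t \<cdot>\<^sub>v v)"
  define H where "H = (\<lambda>t. mat n p (\<lambda>(i,k). if k = j then h t $ i else 0))"
  have h: "h t \<in> carrier_vec n" for t using x v by (simp add: h_def)
  have H: "H t \<in> carrier_mat n p" for t by (simp add: H_def)
  have hle: "cmod (h t $ i) \<le> 2 * t" if "0 < t" "t \<le> 1" "i < n" for t i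
  proof -
    have t2: "t\<^sup>2 \<le> t" using that by (simp add: power2_eq_square mult_left_le_one_le)
    have "cmod (h t $ i) \<le> \<bar>sqrt (1 - t\<^sup>2) - 1\<bar> * cmod (x $ i) + \<bar>t\<bar> * cmod (v $ i)"
      using norm_triangle_ineq[of "complex_of_real (sqrt (1 - t\<^sup>2) - 1) * x $ i" "complex_of_real t * v $ i"]
        that x v by (simp only: h_def norm_mult norm_of_real) (auto simp: h_def)
    also have "\<dots> \<le> t\<^sup>2 * 1 + t * 1"
      using that t2 x v vv
      by (intro add_mono mult_mono abs_sqrt_one_minus_le unit_vec_entry_le) auto
    finally show ?thesis using t2 by simp
  qed
  have Hle: "cmod (H t $$ (i,k)) \<le> 2 * t" if "0 < t" "t \<le> 1" "i < n" "k < p" for t i k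
    using hle[OF that(1-3)] that by (simp add: H_def)
  have colH: "col (H t) k = (if k = j then h t else 0\<^sub>v n)" if "k < p" for t k
    using that h[of t] by (intro eq_vecI) (auto simp: H_def)
  have tr: "mat_trace (mat_adjoint (H t) * N) = col N j \<bullet>c h t" if N: "N \<in> carrier_mat n p" for N t
  proof -
    have "mat_trace (mat_adjoint (H t) * N) = (\<Sum>k<p. if k = j then col N k \<bullet>c h t else 0)"
      unfolding mat_trace_adjoint_mult[OF H N] using N by (intro sum.cong) (auto simp: colH)
    also have "\<dots> = col N j \<bullet>c h t" using j by simp
    finally show ?thesis .
  qed
  define SM where "SM = (\<Sum>i<n. \<Sum>j<n. cmod (M $$ (i,j)))"
  define SA where "SA = (\<Sum>i<n. \<Sum>j<n. cmod (A $$ (i,j)))"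
  \<comment> \<open>The slope is twice the real part of v^* M x, which is - a \<rho>. The terms of
    \<open>K\<close> come, in order, from the normalising factor, from the quadratic form of M at
    \<open>h t\<close> (entries at most 2 t) and from the Gram change (entries at most 8 p
    t).\<close>
  have "0 \<le> - 2 * a * \<rho>"
  proof (rule local_minimizer_curve[OF loc X, where k = 1 and Y = "\<lambda>t. X + H t" and c = 2
        and K = "2 * \<bar>d\<bar> + SM * 4 + SA * n * (8 * p)\<^sup>2"])
    fix t :: real assume t: "0 < t" "t \<le> 1"
    have t2: "0 \<le> 1 - t\<^sup>2" using t by (simp add: power_le_one)
    show "X + H t \<in> carrier_mat n p" using X H by simp
    show "X + H t \<in> oblique n p"
      unfolding oblique_iff
    proof (intro conjI allI impI)
      fix k assume k: "k < p"
      show "col (X + H t) k \<bullet>c col (X + H t) k = 1"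
      proof (cases "k = j")
        case True
        have "col (X + H t) k = complex_of_real (sqrt (1 - t\<^sup>2)) \<cdot>\<^sub>v x + complex_of_real t \<cdot>\<^sub>v v"
          using True k X H x v
          by (intro eq_vecI) (auto simp: H_def h_def x_def algebra_simps)
        also have "\<dots> \<bullet>c \<dots> = 1"
          by (rule unit_vec_combination) (use x v vv xv t t2 in auto)
        finally show ?thesis .
      next
        case False
        have "col (X + H t) k = col X k"
          using False k X H by (intro eq_vecI) (auto simp: H_def)
        then show ?thesis using cols[OF k] by simp
      qed
    qed (use X H in simp)
    show "cmod ((X + H t) $$ (i,k) - X $$ (i,k)) \<le> 2 * t" if "i < n" "k < p" for i k
      using Hle[OF t that] X that by (simp add: H_def)
    have D: "gram_change X (H t) \<in> carrier_mat n n" using X H[of t] by (auto simp: gram_change_def)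
    \<comment> \<open>Here 8 = 2 + 2 + 4: two mixed products and the quadratic one, where t^2 \<le>
      t is used.\<close>
    have Dle: "cmod (gram_change X (H t) $$ (i,k)) \<le> 8 * p * t" if ik: "i < n" "k < n" for i k
    proof -
      have "cmod (gram_change X (H t) $$ (i,k)) = cmod ((H t * mat_adjoint X) $$ (i,k)
          + (X * mat_adjoint (H t)) $$ (i,k) + (H t * mat_adjoint (H t)) $$ (i,k))"
        using ik X H[of t] by (simp add: gram_change_def del: index_mult_mat(1))
      also have "\<dots> \<le> real p * (2 * t * 1) + real p * (1 * (2 * t)) + real p * (2 * t * (2 * t))"
        by (intro order_trans[OF norm_triangle_ineq] add_mono mult_adjoint_entry_bound)
          (use X H ik t Hle[OF t] oblique_entry_le[OF ob] in auto)
      also have "\<dots> \<le> 8 * p * t"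
        using t by (simp add: mult_left_mono mult_left_le_one_le)
      finally show ?thesis .
    qed
    have cols': "col (M * X) j = M *\<^sub>v x" "col (M * H t) j = M *\<^sub>v h t"
      using M X H[of t] j colH[OF j, of t] by (simp_all add: x_def)
    have carr: "M * X \<in> carrier_mat n p" "M * H t \<in> carrier_mat n p" using M X H by auto
    have comb: "E + 2 * e + q - r \<le> E + 2 * (c - b) + s + u"
      if "e = a - b" "a \<le> c" "q \<le> s" "- r \<le> u" for E a b c e q r s u :: real
      using that by simp
    have "Re ((M *\<^sub>v x) \<bullet>c h t) = (sqrt (1 - t\<^sup>2) - 1) * d - t * (a * \<rho>)"
      using x v M Mxv by (simp add: h_def cscalar_prod_linear flip: d)
    moreover have "(sqrt (1 - t\<^sup>2) - 1) * d \<le> t\<^sup>2 * \<bar>d\<bar>"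
    proof -
      have "(sqrt (1 - t\<^sup>2) - 1) * d \<le> \<bar>sqrt (1 - t\<^sup>2) - 1\<bar> * \<bar>d\<bar>"
        using abs_ge_self[of "(sqrt (1 - t\<^sup>2) - 1) * d"] by (simp only: abs_mult)
      also have "\<dots> \<le> t\<^sup>2 * \<bar>d\<bar>"
        using t2 by (intro mult_right_mono abs_sqrt_one_minus_le) auto
      finally show ?thesis .
    qed
    moreover have "Re ((M *\<^sub>v h t) \<bullet>c h t) \<le> SM * (2 * t)\<^sup>2"
      using hermitian_form_bound[OF M(1) h hle[OF t]] unfolding SM_def by linarith
    moreover have "- Re (mat_trace (A * (gram_change X (H t) * gram_change X (H t))))
        \<le> SA * n * (8 * p * t)\<^sup>2"
      using mat_trace_mult_square_bound[OF A(1) D Dle] unfolding SA_def by linarith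
    ultimately have "qOMM_energy A (X + H t) \<le> qOMM_energy A X
        + 2 * (t\<^sup>2 * \<bar>d\<bar> - t * (a * \<rho>)) + SM * (2 * t)\<^sup>2 + SA * n * (8 * p * t)\<^sup>2"
      unfolding qOMM_energy_add[OF A X H] M_def[symmetric] tr[OF carr(1)] tr[OF carr(2)] cols'
      by (rule comb)
    also have "\<dots> = qOMM_energy A X
        + t ^ 1 * (- 2 * a * \<rho> + (2 * \<bar>d\<bar> + SM * 4 + SA * n * (8 * p)\<^sup>2) * t)"
      by (simp add: algebra_simps power2_eq_square)
    finally show "qOMM_energy A (X + H t) \<le> qOMM_energy A X
        + t ^ 1 * (- 2 * a * \<rho> + (2 * \<bar>d\<bar> + SM * 4 + SA * n * (8 * p)\<^sup>2) * t)" .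
  qed
  moreover have "0 < a * \<rho>" using a \<rho> by simp
  ultimately show False by (simp add: mult.commute)
qed

text \<open>If \<open>w\<close> is in the kernel of \<open>X\<close> and \<open>z\<close> is orthogonal to its range, then
  $t z w^*$, with the columns of \<open>X\<close> shrunk to stay feasible, changes $X X^*$ only to second
  order in \<open>t\<close>.\<close>

lemma local_minimizer_kernel_inequality:
  assumes A: "A \<in> carrier_mat n n" "mat_adjoint A = A"
    and loc: "local_minimizer (qOMM_energy A) (oblique n p) X"
    and eig: "\<And>j. j < p \<Longrightarrow> gradient_mat A X *\<^sub>v col X j = complex_of_real (d j) \<cdot>\<^sub>v col X j"
    and w: "w \<in> carrier_vec p" "w \<bullet>c w = 1" "X *\<^sub>v w = 0\<^sub>v n"
    and z: "z \<in> carrier_vec n" "z \<bullet>c z = 1" "mat_adjoint X *\<^sub>v z = 0\<^sub>v p"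
  shows "(\<Sum>j<p. (cmod (w $ j))\<^sup>2 * d j) \<le> Re ((gradient_mat A X *\<^sub>v z) \<bullet>c z)"
proof -
  define M where "M = gradient_mat A X"
  have ob: "X \<in> oblique n p" using loc by (simp add: local_minimizer_def)
  then have X: "X \<in> carrier_mat n p" and cols: "\<And>k. k < p \<Longrightarrow> col X k \<bullet>c col X k = 1"
    by (auto simp: oblique_iff)
  have M: "M \<in> carrier_mat n n" "mat_adjoint M = M"
    unfolding M_def by (rule gradient_mat_carrier[OF A(1) X] gradient_mat_adjoint[OF A(1) X A(2)])+
  have colX: "col X j \<in> carrier_vec n" if "j < p" for j using X that by simp
  have zx: "z \<bullet>c col X j = 0" if "j < p" for j
  proof -
    have "z \<bullet>c col X j = (mat_adjoint X *\<^sub>v z) $ j"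
      using that z(1) X by (auto simp: scalar_prod_def mult.commute)
    then show ?thesis using z(3) that by simp
  qed
  have xz: "col X j \<bullet>c z = 0" if "j < p" for j
    using cscalar_prod_cnj[of z "col X j"] zx[OF that] z(1) X by simp
  \<comment> \<open>The column is an eigenvector of the Hermitian M and \<open>z\<close> is
    orthogonal to it, so M z is orthogonal to it as well. This removes the mixed terms from the
    quadratic form below.\<close>
  have Mzx: "(M *\<^sub>v z) \<bullet>c col X j = 0" if "j < p" for j
    using mult_mat_vec_cscalar_prod[of M z "col X j"] M z(1) X zx[OF that] eig[OF that]
    by (simp add: cscalar_prod_linear flip: M_def)
  have sw: "(\<Sum>j<p. (cmod (w $ j))\<^sup>2) = 1"
    using w(2) w(1) unfolding cscalar_prod_self using of_real_eq_1_iff by (simp del: of_real_sum)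
  have wle: "cmod (w $ j) \<le> 1" if "j < p" for j using unit_vec_entry_le[OF w(2)] w(1) that by simp
  \<comment> \<open>Column j moves to s x_j + t \<open>cnj (w $ j)\<close> z, which has norm 1
    exactly because x_j and z are orthonormal. The shrink factor depends on j through the size of
    \<open>w $ j\<close>.\<close>
  define s where "s = (\<lambda>t j. sqrt (1 - t\<^sup>2 * (cmod (w $ j))\<^sup>2))"
  define h where "h = (\<lambda>t j. complex_of_real (s t j - 1) \<cdot>\<^sub>v col X j
      + (complex_of_real t * cnj (w $ j)) \<cdot>\<^sub>v z)"
  define H where "H = (\<lambda>t. mat n p (\<lambda>(i,j). h t j $ i))"
  define \<zeta> where "\<zeta> = Re ((M *\<^sub>v z) \<bullet>c z)"
  define SA where "SA = (\<Sum>i<n. \<Sum>j<n. cmod (A $$ (i,j)))"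
  have h: "h t j \<in> carrier_vec n" for t j using X z by (auto simp: h_def)
  have H: "H t \<in> carrier_mat n p" for t by (simp add: H_def)
  have colH: "col (H t) j = h t j" if "j < p" for t j
    using that h[of t j] by (intro eq_vecI) (auto simp: H_def)
  have tw: "0 \<le> t\<^sup>2 * (cmod (w $ j))\<^sup>2" "t\<^sup>2 * (cmod (w $ j))\<^sup>2 \<le> t\<^sup>2" "t\<^sup>2 \<le> 1"
    if "0 < t" "t \<le> 1" "j < p" for t :: real and j
    using wle[OF that(3)] that by (simp_all add: power_le_one mult_left_le)
  have s_le: "\<bar>s t j - 1\<bar> \<le> t\<^sup>2" if "0 < t" "t \<le> 1" "j < p" for t j
    using abs_sqrt_one_minus_le[of "t\<^sup>2 * (cmod (w $ j))\<^sup>2"] tw[OF that]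
    unfolding s_def by linarith
  have s_sq: "(s t j)\<^sup>2 = 1 - t\<^sup>2 * (cmod (w $ j))\<^sup>2" if "0 < t" "t \<le> 1" "j < p" for t j
    using tw[OF that] by (simp add: s_def)
  have Hle: "cmod (H t $$ (i,j)) \<le> 2 * t" if "0 < t" "t \<le> 1" "i < n" "j < p" for t i j
  proof -
    have t2: "t\<^sup>2 \<le> t" using that by (simp add: power2_eq_square mult_left_le_one_le)
    have "H t $$ (i,j) = complex_of_real (s t j - 1) * X $$ (i,j)
        + complex_of_real t * cnj (w $ j) * z $ i"
      using that X z by (simp add: H_def h_def)
    then have "cmod (H t $$ (i,j)) \<le> cmod (complex_of_real (s t j - 1) * X $$ (i,j))
        + cmod (complex_of_real t * cnj (w $ j) * z $ i)"
      using norm_triangle_ineq by simp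
    also have "\<dots> = \<bar>s t j - 1\<bar> * cmod (X $$ (i,j)) + \<bar>t\<bar> * cmod (w $ j) * cmod (z $ i)"
      by (simp only: norm_mult norm_of_real complex_mod_cnj)
    also have "\<dots> \<le> t\<^sup>2 * 1 + t * 1 * 1"
      using that z(1) wle
      by (intro add_mono mult_mono s_le oblique_entry_le[OF ob] unit_vec_entry_le[OF z(2)]) auto
    finally show ?thesis using t2 by simp
  qed
  \<comment> \<open>The part of first order in t is t z (X w)^* = 0; only the shrink factors remain,
    each contributing at most t^2.\<close>
  have HXle: "cmod ((H t * mat_adjoint X) $$ (i,k)) \<le> p * t\<^sup>2"
    if t: "0 < t" "t \<le> 1" and ik: "i < n" "k < n" for t :: real and i k
  proof -
    have "(H t * mat_adjoint X) $$ (i,k) = (\<Sum>j<p. H t $$ (i,j) * cnj (X $$ (k,j)))"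
      using ik X H[of t] by (simp add: scalar_prod_def atLeast0LessThan)
    also have "\<dots> = (\<Sum>j<p. complex_of_real (s t j - 1) * X $$ (i,j) * cnj (X $$ (k,j)))
        + complex_of_real t * z $ i * cnj (\<Sum>j<p. X $$ (k,j) * w $ j)"
      using ik X z
      by (simp add: H_def h_def sum.distrib sum_subtractf sum_distrib_left algebra_simps)
    also have "(\<Sum>j<p. X $$ (k,j) * w $ j) = (X *\<^sub>v w) $ k"
      using ik X w(1) by (simp add: scalar_prod_def atLeast0LessThan)
    also have "\<dots> = 0" using w(3) ik by simp
    finally have "cmod ((H t * mat_adjoint X) $$ (i,k))
        = cmod (\<Sum>j<p. complex_of_real (s t j - 1) * X $$ (i,j) * cnj (X $$ (k,j)))" by simp
    also have "\<dots> \<le> (\<Sum>j<p. t\<^sup>2 * 1 * 1)"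
      by (rule sum_norm_le) (simp only: norm_mult norm_of_real complex_mod_cnj, intro mult_mono,
        use t ik s_le oblique_entry_le[OF ob] in auto)
    finally show ?thesis by simp
  qed
  \<comment> \<open>The Gram change has entries at most 6 p t^2, with 6 = 1 + 1 + 4. Its square is
    of order t^4 \<le> t^3, and this is all that \<open>K\<close> has to absorb.\<close>
  have "0 \<le> \<zeta> - (\<Sum>j<p. (cmod (w $ j))\<^sup>2 * d j)"
  proof (rule local_minimizer_curve[OF loc X, where k = 2 and Y = "\<lambda>t. X + H t" and c = 2
        and K = "SA * n * (6 * p)\<^sup>2"])
    fix t :: real assume t: "0 < t" "t \<le> 1"
    show "X + H t \<in> carrier_mat n p" using X H by simp
    show "X + H t \<in> oblique n p"
      unfolding oblique_iff
    proof (intro conjI allI impI)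
      fix j assume j: "j < p"
      have "col (X + H t) j = complex_of_real (s t j) \<cdot>\<^sub>v col X j
          + (complex_of_real t * cnj (w $ j)) \<cdot>\<^sub>v z"
        using j X H z by (intro eq_vecI) (auto simp: H_def h_def algebra_simps)
      also have "\<dots> \<bullet>c \<dots> = 1"
        by (rule unit_vec_combination)
          (use X j z cols xz s_sq[OF t] in \<open>auto simp: norm_mult power_mult_distrib\<close>)
      finally show "col (X + H t) j \<bullet>c col (X + H t) j = 1" .
    qed (use X H in simp)
    show "cmod ((X + H t) $$ (i,k) - X $$ (i,k)) \<le> 2 * t" if "i < n" "k < p" for i k
      using Hle[OF t that] X that by (simp add: H_def)
    have D: "gram_change X (H t) \<in> carrier_mat n n" using X H[of t] by (auto simp: gram_change_def)
    have Dle: "cmod (gram_change X (H t) $$ (i,k)) \<le> 6 * p * t\<^sup>2" if ik: "i < n" "k < n" for i k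
    proof -
      have "X * mat_adjoint (H t) = mat_adjoint (H t * mat_adjoint X)"
        using X H[of t] by (subst mat_adjoint_mult_dim) auto
      then have XH: "(X * mat_adjoint (H t)) $$ (i,k) = cnj ((H t * mat_adjoint X) $$ (k,i))"
        using X H[of t] ik by (simp del: index_mult_mat(1))
      have "cmod (gram_change X (H t) $$ (i,k)) = cmod ((H t * mat_adjoint X) $$ (i,k)
          + cnj ((H t * mat_adjoint X) $$ (k,i)) + (H t * mat_adjoint (H t)) $$ (i,k))"
        using ik X H[of t] XH by (simp add: gram_change_def del: index_mult_mat(1))
      also have "\<dots> \<le> p * t\<^sup>2 + p * t\<^sup>2 + real p * (2 * t * (2 * t))"
        by (intro order_trans[OF norm_triangle_ineq] add_mono mult_adjoint_entry_bound)
          (use X H ik t Hle[OF t] HXle[OF t] in \<open>auto simp del: index_mult_mat(1)\<close>)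
      also have "\<dots> = 6 * p * t\<^sup>2" by (simp add: power2_eq_square)
      finally show ?thesis .
    qed
    have carr: "M * X \<in> carrier_mat n p" "M * H t \<in> carrier_mat n p" using M X H by auto
    have Mh: "M *\<^sub>v h t j = complex_of_real ((s t j - 1) * d j) \<cdot>\<^sub>v col X j
        + (complex_of_real t * cnj (w $ j)) \<cdot>\<^sub>v (M *\<^sub>v z)" if "j < p" for j
      using M z colX[OF that] eig[OF that] unfolding h_def
      by (simp add: mult_add_distrib_mat_vec[of _ n n] mult_mat_vec[of _ n n] smult_smult_assoc
          flip: M_def)
    have lin: "Re (mat_trace (mat_adjoint (H t) * (M * X))) = (\<Sum>j<p. d j * (s t j - 1))"
    proof -
      have "col (M * X) j \<bullet>c col (H t) j = complex_of_real (d j * (s t j - 1))" if "j < p" for j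
        using that M X z cols xz eig[OF that] colH[OF that, of t]
        by (simp add: h_def cscalar_prod_linear flip: M_def)
      then show ?thesis unfolding mat_trace_adjoint_mult[OF H carr(1)] by simp
    qed
    have quad: "Re (mat_trace (mat_adjoint (H t) * (M * H t)))
        = (\<Sum>j<p. (s t j - 1)\<^sup>2 * d j + t\<^sup>2 * (cmod (w $ j))\<^sup>2 * \<zeta>)"
    proof -
      have "Re (col (M * H t) j \<bullet>c col (H t) j)
          = (s t j - 1)\<^sup>2 * d j + t\<^sup>2 * (cmod (w $ j))\<^sup>2 * \<zeta>" if j: "j < p" for j
      proof -
        have "col (M * H t) j \<bullet>c col (H t) j = complex_of_real ((s t j - 1) * d j) * complex_of_real (s t j - 1)
          + (complex_of_real t * cnj (w $ j)) * (complex_of_real t * w $ j) * ((M *\<^sub>v z) \<bullet>c z)"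
          using j M X H[of t] z cols xz Mzx colH[OF j, of t] Mh[OF j]
          unfolding h_def by (simp add: cscalar_prod_linear del: of_real_diff of_real_mult)
        also have "(complex_of_real t * cnj (w $ j)) * (complex_of_real t * w $ j)
            = complex_of_real (t\<^sup>2 * (cmod (w $ j))\<^sup>2)"
          using complex_norm_square[of "w $ j"] by (simp add: power2_eq_square mult_ac)
        finally show ?thesis by (simp add: \<zeta>_def power2_eq_square del: of_real_mult of_real_diff)
      qed
      then show ?thesis unfolding mat_trace_adjoint_mult[OF H carr(2)] by simp
    qed
    \<comment> \<open>Twice s - 1 plus its square is s^2 - 1, which is - t^2 times the squared
      modulus of \<open>w $ j\<close>: the square roots cancel exactly and no error of order t^2 is
      left.\<close>
    have "2 * (\<Sum>j<p. d j * (s t j - 1)) + (\<Sum>j<p. (s t j - 1)\<^sup>2 * d j + t\<^sup>2 * (cmod (w $ j))\<^sup>2 * \<zeta>)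
        = (\<Sum>j<p. d j * ((s t j)\<^sup>2 - 1) + t\<^sup>2 * (cmod (w $ j))\<^sup>2 * \<zeta>)"
      unfolding sum_distrib_left sum.distrib[symmetric]
      by (intro sum.cong) (simp_all add: power2_eq_square algebra_simps)
    also have "\<dots> = (\<Sum>j<p. (t\<^sup>2 * \<zeta>) * (cmod (w $ j))\<^sup>2 - t\<^sup>2 * ((cmod (w $ j))\<^sup>2 * d j))"
      by (intro sum.cong) (simp_all add: s_sq[OF t] algebra_simps)
    also have "\<dots> = t\<^sup>2 * (\<zeta> - (\<Sum>j<p. (cmod (w $ j))\<^sup>2 * d j))"
      by (simp add: sum_subtractf sw right_diff_distrib flip: sum_distrib_left)
    finally have main: "2 * (\<Sum>j<p. d j * (s t j - 1))
        + (\<Sum>j<p. (s t j - 1)\<^sup>2 * d j + t\<^sup>2 * (cmod (w $ j))\<^sup>2 * \<zeta>)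
        = t\<^sup>2 * (\<zeta> - (\<Sum>j<p. (cmod (w $ j))\<^sup>2 * d j))" .
    have SA: "0 \<le> SA" by (simp add: SA_def sum_nonneg)
    have "- Re (mat_trace (A * (gram_change X (H t) * gram_change X (H t))))
        \<le> SA * n * (6 * p * t\<^sup>2)\<^sup>2"
      using mat_trace_mult_square_bound[OF A(1) D Dle] unfolding SA_def by linarith
    also have "\<dots> = SA * n * (6 * p)\<^sup>2 * t ^ 4" by (simp add: power_mult_distrib flip: power_mult)
    also have "\<dots> \<le> SA * n * (6 * p)\<^sup>2 * t ^ 3"
      using t SA by (intro mult_left_mono power_decreasing) auto
    finally have "qOMM_energy A (X + H t) \<le> qOMM_energy A X
        + t\<^sup>2 * (\<zeta> - (\<Sum>j<p. (cmod (w $ j))\<^sup>2 * d j)) + SA * n * (6 * p)\<^sup>2 * t ^ 3"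
      unfolding qOMM_energy_add[OF A X H] M_def[symmetric] lin quad using main by linarith
    then show "qOMM_energy A (X + H t) \<le> qOMM_energy A X
        + t\<^sup>2 * (\<zeta> - (\<Sum>j<p. (cmod (w $ j))\<^sup>2 * d j) + SA * n * (6 * p)\<^sup>2 * t)"
      by (simp add: algebra_simps power2_eq_square power3_eq_cube)
  qed
  then show ?thesis by (simp add: \<zeta>_def M_def)
qed

section \<open>The Gram matrix of a stationary point\<close>

lemma unitary_rightI:
  fixes U :: "complex mat"
  assumes "U \<in> carrier_mat n n" "mat_adjoint U * U = 1\<^sub>m n"
  shows "U * mat_adjoint U = 1\<^sub>m n"
  by (rule mat_mult_left_right_inverse[OF mat_adjoint_carrier[OF assms(1)] assms])

text \<open>Put u = X w and compute u^* M u twice. From M X = X D and X^* u = c w it is c w^* D w;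
  from G u = c u, with G = X X^*, the definition of M makes it 2 (1 - c) u^* A u.\<close>

lemma gradient_form_at_gram_eigenvector:
  assumes A: "A \<in> carrier_mat n n" "mat_adjoint A = A" and X: "X \<in> carrier_mat n p"
    and MX: "gradient_mat A X * X = X * D" and D: "D \<in> carrier_mat p p"
    and w: "w \<in> carrier_vec p" "mat_adjoint X * X *\<^sub>v w = complex_of_real c \<cdot>\<^sub>v w"
  shows "complex_of_real c * ((D *\<^sub>v w) \<bullet>c w)
      = 2 * (1 - complex_of_real c) * ((A *\<^sub>v (X *\<^sub>v w)) \<bullet>c (X *\<^sub>v w))"
proof -
  define M where "M = gradient_mat A X"
  define u where "u = X *\<^sub>v w"
  have dims: "dim_row A = n" "dim_col A = n" "dim_row X = n" "dim_col X = p"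
    "dim_row D = p" "dim_col D = p" "dim_vec w = p" "dim_vec u = n"
    using A X w D by (auto simp: u_def)
  have Xu: "mat_adjoint X *\<^sub>v u = complex_of_real c \<cdot>\<^sub>v w"
    using w(2) by (simp add: u_def mult_mat_vec_assoc_dim dims)
  have Gu: "X *\<^sub>v (mat_adjoint X *\<^sub>v u) = complex_of_real c \<cdot>\<^sub>v u"
    unfolding Xu by (simp add: u_def mult_mat_vec[OF X w(1)])
  have "M *\<^sub>v u = X *\<^sub>v (D *\<^sub>v w)"
  proof -
    have "M *\<^sub>v u = M * X *\<^sub>v w"
      unfolding u_def using X w(1)
      by (subst mult_mat_vec_assoc_dim) (auto simp: M_def gradient_mat_def dims)
    then show ?thesis by (simp add: M_def MX mult_mat_vec_assoc_dim dims)
  qed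
  then have "(M *\<^sub>v u) \<bullet>c u = (D *\<^sub>v w) \<bullet>c (mat_adjoint X *\<^sub>v u)"
    by (simp add: mult_mat_vec_cscalar_prod dims)
  also have "\<dots> = complex_of_real c * ((D *\<^sub>v w) \<bullet>c w)"
    by (simp add: Xu cscalar_prod_linear dims)
  finally have 1: "(M *\<^sub>v u) \<bullet>c u = complex_of_real c * ((D *\<^sub>v w) \<bullet>c w)" .
  have "M *\<^sub>v u = (2 \<cdot>\<^sub>v (A *\<^sub>v u) - X *\<^sub>v (mat_adjoint X *\<^sub>v (A *\<^sub>v u)))
      - A *\<^sub>v (X *\<^sub>v (mat_adjoint X *\<^sub>v u))"
  proof -
    have u: "u \<in> carrier_vec n" by (intro carrier_vecI) (simp add: dims)
    have c: "2 \<cdot>\<^sub>m A \<in> carrier_mat n n" "X * mat_adjoint X * A \<in> carrier_mat n n"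
      "2 \<cdot>\<^sub>m A - X * mat_adjoint X * A \<in> carrier_mat n n"
      "A * (X * mat_adjoint X) \<in> carrier_mat n n"
      by (intro carrier_matI; simp add: dims)+
    have "2 \<cdot>\<^sub>m A *\<^sub>v u = 2 \<cdot>\<^sub>v (A *\<^sub>v u)"
      by (rule eq_vecI) (simp_all add: dims)
    then show ?thesis
      unfolding M_def gradient_mat_def minus_mult_distrib_mat_vec[OF c(3,4) u]
        minus_mult_distrib_mat_vec[OF c(1,2) u]
      by (simp add: mult_mat_vec_assoc_dim dims)
  qed
  also have "A *\<^sub>v (X *\<^sub>v (mat_adjoint X *\<^sub>v u)) = complex_of_real c \<cdot>\<^sub>v (A *\<^sub>v u)"
    unfolding Gu by (rule mult_mat_vec[OF A(1)]) (simp add: carrier_vecI dims)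
  finally have "(M *\<^sub>v u) \<bullet>c u = 2 * ((A *\<^sub>v u) \<bullet>c u)
      - (X *\<^sub>v (mat_adjoint X *\<^sub>v (A *\<^sub>v u))) \<bullet>c u - complex_of_real c * ((A *\<^sub>v u) \<bullet>c u)"
    by (simp add: cscalar_prod_linear dims)
  also have "(X *\<^sub>v (mat_adjoint X *\<^sub>v (A *\<^sub>v u))) \<bullet>c u = (A *\<^sub>v u) \<bullet>c (X *\<^sub>v (mat_adjoint X *\<^sub>v u))"
    by (simp add: mult_mat_vec_cscalar_prod dims)
  also have "\<dots> = complex_of_real c * ((A *\<^sub>v u) \<bullet>c u)"
    unfolding Gu by (simp add: cscalar_prod_linear dims)
  finally have "(M *\<^sub>v u) \<bullet>c u = 2 * (1 - complex_of_real c) * ((A *\<^sub>v u) \<bullet>c u)"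
    by (simp add: algebra_simps)
  then show ?thesis using 1 unfolding u_def by simp
qed

text \<open>Let $X^*X$ have eigenpairs $(c_k, w_k)$ and put $\delta_k = w_k^* D w_k$. As $X^*X$ has unit
  diagonal, $\sum_k (c_k - 1)\delta_k = \mathrm{tr}((X^*X - I)D) = 0$, and stationarity gives
  $c_k\delta_k = 2(c_k - 1) b_k$ with $b_k = - (X w_k)^* A X w_k \ge 0$. So unless some $c_k = 0$ has
  $\delta_k \ge 0$, every summand is nonnegative, hence zero, and all $c_k$ are 1.\<close>

lemma stationary_orthonormal_or_kernel:
  assumes A: "A \<in> carrier_mat n n" "negative_definite_mat A" and ob: "X \<in> oblique n p"
    and eig: "\<And>j. j < p \<Longrightarrow> gradient_mat A X *\<^sub>v col X j = complex_of_real (d j) \<cdot>\<^sub>v col X j"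
  shows "mat_adjoint X * X = 1\<^sub>m p \<or>
    (\<exists>w \<in> carrier_vec p. w \<bullet>c w = 1 \<and> X *\<^sub>v w = 0\<^sub>v n \<and> 0 \<le> (\<Sum>j<p. (cmod (w $ j))\<^sup>2 * d j))"
proof (rule disjCI)
  assume nker: "\<not> (\<exists>w \<in> carrier_vec p. w \<bullet>c w = 1 \<and> X *\<^sub>v w = 0\<^sub>v n
    \<and> 0 \<le> (\<Sum>j<p. (cmod (w $ j))\<^sup>2 * d j))"
  have herm: "mat_adjoint A = A"
    using A(2) by (simp add: negative_definite_mat_def hermitian_mat_adjoint)
  have X: "X \<in> carrier_mat n p" and cols: "\<And>k. k < p \<Longrightarrow> col X k \<bullet>c col X k = 1"
    using ob by (auto simp: oblique_iff)
  define C where "C = mat_adjoint X * X"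
  define D where "D = mat_diag p (\<lambda>j. complex_of_real (d j))"
  have C: "C \<in> carrier_mat p p" using X by (auto simp: C_def)
  have D: "D \<in> carrier_mat p p" by (simp add: D_def)
  have MX: "gradient_mat A X * X = X * D"
    unfolding D_def mult_mat_diag_iff[OF gradient_mat_carrier[OF A(1) X] X] using eig by blast
  have "hermitian_mat C"
    using C X by (intro hermitian_matI[of _ p]) (auto simp: C_def mat_adjoint_mult_dim)
  then obtain W where W: "W \<in> carrier_mat p p" "mat_adjoint W * W = 1\<^sub>m p"
    "C * W = W * mat_diag p (\<lambda>i. complex_of_real (sorted_eigenvalues C ! i))"
    using hermitian_sorted_eigenbasis[OF C] by blast
  define c where "c = (\<lambda>k. sorted_eigenvalues C ! k)"
  define \<delta> where "\<delta> = (\<lambda>k. \<Sum>j<p. (cmod (W $$ (j,k)))\<^sup>2 * d j)"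
  have WW: "W * mat_adjoint W = 1\<^sub>m p" by (rule unitary_rightI[OF W(1,2)])
  have C_eq: "C = W * mat_diag p (\<lambda>i. complex_of_real (c i)) * mat_adjoint W"
  proof -
    have "C = C * (W * mat_adjoint W)" using C by (simp add: WW)
    also have "\<dots> = C * W * mat_adjoint W"
      using C W(1) by (subst mult_mat_assoc_dim) auto
    finally show ?thesis unfolding W(3) c_def .
  qed
  \<comment> \<open>Rows of the unitary \<open>W\<close> have norm 1 and X^*X has unit diagonal.
    Written in the eigenbasis these are two weighted sums with the same value; their difference
    yields the trace identity \<open>zero\<close>.\<close>
  have row1: "(\<Sum>k<p. (cmod (W $$ (j,k)))\<^sup>2) = 1" if j: "j < p" for j
  proof -
    have "complex_of_real (\<Sum>k<p. (cmod (W $$ (j,k)))\<^sup>2) = (W * mat_adjoint W) $$ (j,j)"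
      using j W(1) complex_norm_square
      by (simp add: scalar_prod_def atLeast0LessThan del: of_real_power)
    then show ?thesis using WW j of_real_eq_1_iff by (metis index_one_mat(1))
  qed
  have rowc: "(\<Sum>k<p. c k * (cmod (W $$ (j,k)))\<^sup>2) = 1" if j: "j < p" for j
  proof -
    have "complex_of_real (\<Sum>k<p. c k * (cmod (W $$ (j,k)))\<^sup>2)
        = (\<Sum>k<p. complex_of_real (c k) * (W $$ (j,k) * cnj (W $$ (j,k))))"
      by (simp add: complex_norm_square[symmetric])
    also have "\<dots> = (W * mat_diag p (\<lambda>i. complex_of_real (c i)) * mat_adjoint W) $$ (j,j)"
      using j W(1)
      by (simp add: mat_diag_mult_right[OF W(1)] scalar_prod_def atLeast0LessThan mult_ac)
    also have "\<dots> = C $$ (j,j)" using C_eq by simp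
    also have "\<dots> = 1" using X j cols[OF j] by (simp add: C_def index_mat_adjoint_mult del: index_mult_mat(1))
    finally show ?thesis using of_real_eq_1_iff by blast
  qed
  have zero: "(\<Sum>k<p. (c k - 1) * \<delta> k) = 0"
  proof -
    have "(\<Sum>k<p. (c k - 1) * \<delta> k)
        = (\<Sum>k<p. \<Sum>j<p. d j * (c k * (cmod (W $$ (j,k)))\<^sup>2 - (cmod (W $$ (j,k)))\<^sup>2))"
      by (simp add: \<delta>_def sum_distrib_left algebra_simps)
    also have "\<dots> = (\<Sum>j<p. \<Sum>k<p. d j * (c k * (cmod (W $$ (j,k)))\<^sup>2 - (cmod (W $$ (j,k)))\<^sup>2))"
      by (rule sum.swap)
    also have "\<dots> = (\<Sum>j<p. d j * ((\<Sum>k<p. c k * (cmod (W $$ (j,k)))\<^sup>2) - (\<Sum>k<p. (cmod (W $$ (j,k)))\<^sup>2)))"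
      by (simp add: sum_distrib_left sum_subtractf right_diff_distrib)
    also have "\<dots> = 0" by (simp add: row1 rowc)
    finally show ?thesis .
  qed
  have key: "0 \<le> (c k - 1) * \<delta> k \<and> ((c k - 1) * \<delta> k = 0 \<longrightarrow> c k = 1)" if k: "k < p" for k
  proof -
    define w where "w = col W k"
    define u where "u = X *\<^sub>v w"
    define b where "b = - Re ((A *\<^sub>v u) \<bullet>c u)"
    have w: "w \<in> carrier_vec p" using W(1) k by (simp add: w_def)
    have u: "u \<in> carrier_vec n" using X w by (simp add: u_def)
    have ww: "w \<bullet>c w = 1" using W(2) k unfolding orthonormal_cols_iff[OF W(1)] w_def by simp
    have Cw: "C *\<^sub>v w = complex_of_real (c k) \<cdot>\<^sub>v w"
      using W(3) k unfolding mult_mat_diag_iff[OF C W(1)] w_def c_def by blast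
    have "u \<bullet>c u = w \<bullet>c (C *\<^sub>v w)"
      unfolding u_def C_def using X w by (simp add: mult_mat_vec_cscalar_prod mult_mat_vec_assoc_dim)
    also have "\<dots> = complex_of_real (c k)" using w ww by (simp add: Cw cscalar_prod_linear)
    finally have uu: "u \<bullet>c u = complex_of_real (c k)" .
    have Dw: "(D *\<^sub>v w) \<bullet>c w = complex_of_real (\<delta> k)"
    proof -
      have "(D *\<^sub>v w) $ j = complex_of_real (d j) * w $ j" if "j < p" for j
      proof -
        have "(D *\<^sub>v w) $ j = (D * W) $$ (j,k)" using D W(1) that k by (simp add: w_def)
        also have "\<dots> = complex_of_real (d j) * w $ j"
          using that k W(1) by (simp add: D_def mat_diag_mult_left[OF W(1)] w_def)
        finally show ?thesis .
      qed
      then have "(D *\<^sub>v w) \<bullet>c w = (\<Sum>j<p. complex_of_real (d j) * w $ j * cnj (w $ j))"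
        using D w by (simp add: scalar_prod_def[of "D *\<^sub>v w"] atLeast0LessThan
            del: index_mult_mat_vec)
      also have "\<dots> = complex_of_real (\<delta> k)"
        using k W(1) by (simp add: \<delta>_def w_def mult_ac complex_norm_square[symmetric]
            flip: of_real_power)
      finally show ?thesis .
    qed
    have "complex_of_real (c k) * complex_of_real (\<delta> k)
        = 2 * (1 - complex_of_real (c k)) * ((A *\<^sub>v u) \<bullet>c u)"
      using gradient_form_at_gram_eigenvector[OF A(1) herm X MX D w Cw[unfolded C_def]]
      unfolding Dw u_def .
    then have "Re (complex_of_real (c k * \<delta> k)) = Re (complex_of_real (2 * (1 - c k)) * ((A *\<^sub>v u) \<bullet>c u))"
      by simp
    then have "c k * \<delta> k = 2 * (1 - c k) * Re ((A *\<^sub>v u) \<bullet>c u)"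
      by (simp only: Re_complex_of_real times_complex.sel Im_complex_of_real mult_zero_left diff_zero)
    then have eq: "c k * \<delta> k = 2 * (c k - 1) * b" by (simp add: b_def algebra_simps)
    have "0 \<le> c k" using cscalar_prod_self_nonneg[of u] uu by simp
    then consider "c k = 0" | "0 < c k" by linarith
    then show ?thesis
    proof cases
      \<comment> \<open>Here w lies in the kernel of X, so the excluded alternative makes
        \<open>\<delta> k\<close> negative, and the summand - \<open>\<delta> k\<close> is strictly
        positive.\<close>
      case 1
      then have "u = 0\<^sub>v n" using uu conjugate_square_eq_0_vec[OF u] by simp
      then have "\<not> 0 \<le> \<delta> k" using nker w ww k W(1) unfolding u_def \<delta>_def w_def by auto
      then show ?thesis using 1 by simp
    next
      case 2
      then have "u \<noteq> 0\<^sub>v n" using uu by auto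
      then have b: "0 < b" using A u by (simp add: negative_definite_mat_def b_def)
      \<comment> \<open>Solving for \<open>\<delta> k\<close> turns the summand into a square with a
        positive weight, which vanishes only for c = 1.\<close>
      have "\<delta> k = 2 * (c k - 1) * b / c k" using eq 2 by (simp add: field_simps)
      then have d: "(c k - 1) * \<delta> k = 2 * (c k - 1)\<^sup>2 * b / c k" by (simp add: power2_eq_square)
      show ?thesis unfolding d using b 2 by simp
    qed
  qed
  have "\<forall>k\<in>{..<p}. (c k - 1) * \<delta> k = 0"
    using zero key by (subst (asm) sum_nonneg_eq_0_iff) auto
  then have "c k = 1" if "k < p" for k using key that by blast
  then have "mat_diag p (\<lambda>i. complex_of_real (c i)) = 1\<^sub>m p"
    by (intro eq_matI) (auto simp: mat_diag_def)
  then show "mat_adjoint X * X = 1\<^sub>m p"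
    using C_eq W(1) WW by (simp add: C_def)
qed

text \<open>Padding \<open>X\<close> with zero columns makes it a singular square matrix.\<close>

lemma kernel_imp_left_kernel:
  fixes X :: "complex mat"
  assumes X: "X \<in> carrier_mat n p" and "p \<le> n"
    and w: "w \<in> carrier_vec p" "w \<noteq> 0\<^sub>v p" "X *\<^sub>v w = 0\<^sub>v n"
  obtains z where "z \<in> carrier_vec n" "z \<bullet>c z = 1" "mat_adjoint X *\<^sub>v z = 0\<^sub>v p"
proof -
  define Y where "Y = mat n n (\<lambda>(i,j). if j < p then X $$ (i,j) else 0)"
  define y where "y = vec n (\<lambda>j. if j < p then w $ j else 0)"
  have Y: "Y \<in> carrier_mat n n" and y: "y \<in> carrier_vec n" by (simp_all add: Y_def y_def)
  obtain j where j: "j < p" "w $ j \<noteq> 0" using w(1,2) by (auto simp: vec_eq_iff)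
  have "y \<noteq> 0\<^sub>v n"
  proof
    assume "y = 0\<^sub>v n"
    then have "y $ j = 0" using j assms(2) by simp
    then show False using j assms(2) by (simp add: y_def)
  qed
  moreover have "Y *\<^sub>v y = 0\<^sub>v n"
  proof (rule eq_vecI)
    fix i assume "i < dim_vec (0\<^sub>v n :: complex vec)"
    then have i: "i < n" by simp
    have "(Y *\<^sub>v y) $ i = (\<Sum>j<n. if j < p then X $$ (i,j) * w $ j else 0)"
      using i Y y by (simp add: scalar_prod_def atLeast0LessThan Y_def y_def if_distrib cong: if_cong)
    also have "\<dots> = (\<Sum>j<p. X $$ (i,j) * w $ j)"
      using assms(2) by (intro sum.mono_neutral_cong_right) auto
    also have "\<dots> = (X *\<^sub>v w) $ i" using i X w(1) by (simp add: scalar_prod_def atLeast0LessThan)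
    finally show "(Y *\<^sub>v y) $ i = 0\<^sub>v n $ i" using w(3) by simp
  qed (use Y in simp)
  ultimately have "det Y = 0" using det_0_iff_vec_prod_zero[OF Y] y by blast
  moreover have "det (mat_adjoint Y) = cnj (det Y)"
  proof -
    have "mat_adjoint Y = map_mat cnj (transpose_mat Y)" using Y by (intro eq_matI) auto
    moreover have "det (map_mat cnj (transpose_mat Y)) = cnj (det (transpose_mat Y))"
      using Y by (simp add: det_def) 
    ultimately show ?thesis using det_transpose[OF Y] by simp
  qed
  ultimately have "det (mat_adjoint Y) = 0" by simp
  then obtain z where z: "z \<in> carrier_vec n" "z \<noteq> 0\<^sub>v n" "mat_adjoint Y *\<^sub>v z = 0\<^sub>v n"
    using det_0_iff_vec_prod_zero[OF mat_adjoint_carrier[OF Y]] by blast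
  obtain a :: real where a: "0 < a" "(complex_of_real a \<cdot>\<^sub>v z) \<bullet>c (complex_of_real a \<cdot>\<^sub>v z) = 1"
    using normalise_vec[OF z(1,2)] by blast
  \<comment> \<open>The first p rows of Y^* are those of X^*, padded with nothing, so a kernel
    vector of Y^* is orthogonal to every column of X.\<close>
  have "mat_adjoint X *\<^sub>v (complex_of_real a \<cdot>\<^sub>v z) = 0\<^sub>v p"
  proof (rule eq_vecI)
    fix j assume "j < dim_vec (0\<^sub>v p :: complex vec)"
    then have j: "j < p" "j < n" using assms(2) by auto
    have "(mat_adjoint X *\<^sub>v (complex_of_real a \<cdot>\<^sub>v z)) $ j = complex_of_real a * (mat_adjoint Y *\<^sub>v z) $ j"
      using j X Y z(1)
      by (simp add: scalar_prod_def Y_def sum_distrib_left mult_ac)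
    then show "(mat_adjoint X *\<^sub>v (complex_of_real a \<cdot>\<^sub>v z)) $ j = 0\<^sub>v p $ j" using z(3) j by simp
  qed (use X in simp)
  with a z(1) show ?thesis by (intro that[of "complex_of_real a \<cdot>\<^sub>v z"]) auto
qed

text \<open>If X^*X \<noteq> I, there are a kernel vector w and a left kernel vector z, and z^* M z
  = 2 z^* A z < 0 contradicts w^* D w \<ge> 0. Once X^*X = I, the matrix M X is the component of A X
  orthogonal to the range of X; being also X D, it must vanish.\<close>

lemma local_minimizer_orthonormal_invariant:
  assumes A: "A \<in> carrier_mat n n" "negative_definite_mat A" and "p \<le> n"
    and loc: "local_minimizer (qOMM_energy A) (oblique n p) X"
  shows "mat_adjoint X * X = 1\<^sub>m p" and "A * X = X * (mat_adjoint X * A * X)"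
proof -
  define M where "M = gradient_mat A X"
  define d where "d = (\<lambda>j. Re ((M *\<^sub>v col X j) \<bullet>c col X j))"
  have herm: "mat_adjoint A = A"
    using A(2) by (simp add: negative_definite_mat_def hermitian_mat_adjoint)
  have ob: "X \<in> oblique n p" using loc by (simp add: local_minimizer_def)
  then have X: "X \<in> carrier_mat n p" by (simp add: oblique_iff)
  have M: "M \<in> carrier_mat n n" unfolding M_def by (rule gradient_mat_carrier[OF A(1) X])
  have dims: "dim_row A = n" "dim_col A = n" "dim_row X = n" "dim_col X = p"
    "dim_row M = n" "dim_col M = n" using A X M by auto
  have eig: "gradient_mat A X *\<^sub>v col X j = complex_of_real (d j) \<cdot>\<^sub>v col X j" if "j < p" for j
    using local_minimizer_gradient_eigenvector[OF A(1) herm loc that] by (simp add: d_def M_def)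
  show XX: "mat_adjoint X * X = 1\<^sub>m p"
  proof (rule ccontr)
    assume "mat_adjoint X * X \<noteq> 1\<^sub>m p"
    then obtain w where w: "w \<in> carrier_vec p" "w \<bullet>c w = 1" "X *\<^sub>v w = 0\<^sub>v n"
      "0 \<le> (\<Sum>j<p. (cmod (w $ j))\<^sup>2 * d j)"
      using stationary_orthonormal_or_kernel[OF A ob eig] by blast
    have "w \<noteq> 0\<^sub>v p" using w(2) by auto
    then obtain z where z: "z \<in> carrier_vec n" "z \<bullet>c z = 1" "mat_adjoint X *\<^sub>v z = 0\<^sub>v p"
      using kernel_imp_left_kernel[OF X assms(3) w(1) _ w(3)] by blast
    have zdim: "dim_vec z = n" using z(1) by simp
    have X0: "X *\<^sub>v 0\<^sub>v p = 0\<^sub>v n" using X by (intro eq_vecI) auto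
    have A0: "A *\<^sub>v 0\<^sub>v n = 0\<^sub>v n" using A by (intro eq_vecI) auto
    have "(M *\<^sub>v z) \<bullet>c z = 2 * ((A *\<^sub>v z) \<bullet>c z)"
    proof -
      have c: "2 \<cdot>\<^sub>m A \<in> carrier_mat n n" "X * mat_adjoint X * A \<in> carrier_mat n n"
        "2 \<cdot>\<^sub>m A - X * mat_adjoint X * A \<in> carrier_mat n n"
        "A * (X * mat_adjoint X) \<in> carrier_mat n n"
        by (intro carrier_matI; simp add: dims)+
      have "2 \<cdot>\<^sub>m A *\<^sub>v z = 2 \<cdot>\<^sub>v (A *\<^sub>v z)"
        by (rule eq_vecI) (simp_all add: dims zdim)
      then have "M *\<^sub>v z = (2 \<cdot>\<^sub>v (A *\<^sub>v z) - X *\<^sub>v (mat_adjoint X *\<^sub>v (A *\<^sub>v z)))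
          - A *\<^sub>v (X *\<^sub>v (mat_adjoint X *\<^sub>v z))"
        unfolding M_def gradient_mat_def minus_mult_distrib_mat_vec[OF c(3,4) z(1)]
          minus_mult_distrib_mat_vec[OF c(1,2) z(1)]
        by (simp add: mult_mat_vec_assoc_dim dims zdim)
      moreover have "(X *\<^sub>v (mat_adjoint X *\<^sub>v (A *\<^sub>v z))) \<bullet>c z = 0"
        using carrier_vecI[of "mat_adjoint X *\<^sub>v (A *\<^sub>v z)" p]
        by (simp add: mult_mat_vec_cscalar_prod dims zdim z(3))
      ultimately show ?thesis
        using z(1) by (simp add: z(3) X0 A0 cscalar_prod_linear dims zdim)
    qed
    moreover have "Re ((A *\<^sub>v z) \<bullet>c z) < 0"
      using A z by (auto simp: negative_definite_mat_def)
    ultimately show False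
      using local_minimizer_kernel_inequality[OF A(1) herm loc eig w(1-3) z] w(4)
      by (simp flip: M_def)
  qed
  have MX: "M * X = A * X - X * (mat_adjoint X * A * X)"
  proof -
    have "M * X = 2 \<cdot>\<^sub>m (A * X) - X * (mat_adjoint X * (A * X)) - A * X"
      using XX X by (simp add: M_def gradient_mat_def mat_distrib_dim smult_mult_dim
          mult_mat_assoc_dim dims)
    also have "\<dots> = A * X - X * (mat_adjoint X * A * X)"
      by (rule eq_matI) (simp_all add: dims mult_mat_assoc_dim del: index_mult_mat(1))
    finally show ?thesis .
  qed
  have XAX: "mat_adjoint X * A * X \<in> carrier_mat p p" by (intro carrier_matI) (simp_all add: dims)
  have "mat_adjoint X * (M * X) = mat_adjoint X * A * X - mat_adjoint X * A * X"
    unfolding MX using XX XAX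
    by (simp add: mat_distrib_dim dims flip: mult_mat_assoc_dim)
  then have XMX: "mat_adjoint X * (M * X) = 0\<^sub>m p p" using XAX by simp
  have "M *\<^sub>v col X j = 0 \<cdot>\<^sub>v col X j" if j: "j < p" for j
  proof -
    have "(M *\<^sub>v col X j) \<bullet>c col X j = (mat_adjoint X * (M * X)) $$ (j,j)"
      using j M X by (simp add: index_mat_adjoint_mult col_mult2[of _ n n] dims del: index_mult_mat(1))
    then have "d j = 0" using XMX j by (simp add: d_def)
    then show ?thesis using eig[OF j] by (simp add: M_def)
  qed
  then have "M * X = X * mat_diag p (\<lambda>j. 0)" unfolding mult_mat_diag_iff[OF M X] by blast
  also have "\<dots> = 0\<^sub>m n p" by (rule eq_matI) (simp_all add: mat_diag_mult_right[OF X] dims)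
  finally have "A * X - X * (mat_adjoint X * A * X) = 0\<^sub>m n p" using MX by simp
  then have "(A * X - X * (mat_adjoint X * A * X)) $$ (i,j) = 0" if "i < n" "j < p" for i j
    using that by simp
  then show "A * X = X * (mat_adjoint X * A * X)"
    by (intro eq_matI) (simp_all add: dims del: index_mult_mat(1))
qed

section \<open>Local minimizers are spanned by the lowest eigenvectors\<close>

lemma negative_definite_imp_hermitian: "negative_definite_mat A \<Longrightarrow> hermitian_mat A"
  by (simp add: negative_definite_mat_def)

lemma frame_times_unitary:
  fixes Q V :: "complex mat"
  assumes Q: "Q \<in> carrier_mat n p" "mat_adjoint Q * Q = 1\<^sub>m p"
    and V: "V \<in> carrier_mat p p" "V * mat_adjoint V = 1\<^sub>m p"
  shows "mat_adjoint (Q * mat_adjoint V) * (Q * mat_adjoint V) = 1\<^sub>m p"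
proof -
  have dims: "dim_row Q = n" "dim_col Q = p" "dim_row V = p" "dim_col V = p" using Q V by auto
  have "mat_adjoint (Q * mat_adjoint V) * (Q * mat_adjoint V)
      = V * ((mat_adjoint Q * Q) * mat_adjoint V)"
    by (simp add: mat_adjoint_mult_dim mult_mat_assoc_dim dims)
  then show ?thesis using Q(2) V by simp
qed

lemma orthonormal_imp_oblique:
  assumes "X \<in> carrier_mat n p" "mat_adjoint X * X = 1\<^sub>m p"
  shows "X \<in> oblique n p"
  using assms by (simp add: oblique_def)

text \<open>For orthonormal columns 2 I - X^*X = I, so the energy is the trace of X^* A X, which the
  unitary factor leaves unchanged. Energies of frames thus become sums of quadratic forms, one per
  column.\<close>

lemma qOMM_energy_frame:
  assumes A: "A \<in> carrier_mat n n" and Q: "Q \<in> carrier_mat n p" "mat_adjoint Q * Q = 1\<^sub>m p"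
    and V: "V \<in> carrier_mat p p" "V * mat_adjoint V = 1\<^sub>m p"
  shows "qOMM_energy A (Q * mat_adjoint V) = (\<Sum>k<p. Re ((A *\<^sub>v col Q k) \<bullet>c col Q k))"
proof -
  define X where "X = Q * mat_adjoint V"
  define N where "N = mat_adjoint Q * (A * Q)"
  have XX: "mat_adjoint X * X = 1\<^sub>m p"
    unfolding X_def by (rule frame_times_unitary[OF Q V])
  have dims: "dim_row A = n" "dim_col A = n" "dim_row Q = n" "dim_col Q = p"
    "dim_row V = p" "dim_col V = p" "dim_row X = n" "dim_col X = p" "dim_row N = p" "dim_col N = p"
    using A Q V by (auto simp: X_def N_def)
  have "mat_adjoint V * V = 1\<^sub>m p"
    by (rule mat_mult_left_right_inverse[OF V(1) mat_adjoint_carrier[OF V(1)] V(2)])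
  then have VN: "mat_adjoint V * (V * N) = N"
    by (subst mult_mat_assoc_dim[symmetric]) (simp_all add: dims)
  have "2 \<cdot>\<^sub>m 1\<^sub>m p - 1\<^sub>m p = (1\<^sub>m p :: complex mat)" by (rule eq_matI) auto
  then have "qOMM_energy A X = Re (mat_trace (1\<^sub>m p * (mat_adjoint X * A * X)))"
    by (simp add: qOMM_energy_def XX dims)
  also have "1\<^sub>m p * (mat_adjoint X * A * X) = mat_adjoint X * A * X"
    by (rule left_mult_one_mat[of _ p p]) (intro carrier_matI; simp add: dims)
  also have "mat_adjoint X * A * X = (V * N) * mat_adjoint V"
    by (simp add: X_def N_def mat_adjoint_mult_dim mult_mat_assoc_dim dims)
  also have "mat_trace \<dots> = mat_trace N"
    by (subst mat_trace_comm_dim) (simp_all add: dims VN)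
  also have "Re (mat_trace N) = (\<Sum>k<p. Re ((A *\<^sub>v col Q k) \<bullet>c col Q k))"
    unfolding N_def using A Q by (simp add: mat_trace_adjoint_mult[of _ n p])
  finally show ?thesis by (simp add: X_def)
qed

lemma eigen_form:
  fixes U :: "complex mat"
  assumes A: "A \<in> carrier_mat n n" and U: "U \<in> carrier_mat n m" "mat_adjoint U * U = 1\<^sub>m m"
    and AU: "A * U = U * mat_diag m (\<lambda>i. complex_of_real (e i))" and i: "i < m"
  shows "(A *\<^sub>v col U i) \<bullet>c col U i = complex_of_real (e i)"
proof -
  have "A *\<^sub>v col U i = complex_of_real (e i) \<cdot>\<^sub>v col U i"
    using AU i unfolding mult_mat_diag_iff[OF A U(1)] by blast
  moreover have "col U i \<bullet>c col U i = 1"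
    using U(2) i unfolding orthonormal_cols_iff[OF U(1)] by simp
  ultimately show ?thesis by (simp add: cscalar_prod_linear)
qed

text \<open>Rotating an eigenvector in the range of \<open>X\<close> towards one outside of it must not decrease
  the energy.\<close>

lemma local_minimizer_eigenvalue_le:
  assumes A: "A \<in> carrier_mat n n" and loc: "local_minimizer (qOMM_energy A) (oblique n p) X"
    and U: "U \<in> carrier_mat n n" "mat_adjoint U * U = 1\<^sub>m n"
    and AU: "A * U = U * mat_diag n (\<lambda>i. complex_of_real (e i))"
    and Q: "Q \<in> carrier_mat n p" and QU: "\<And>k. k < p \<Longrightarrow> col Q k = col U k"
    and V: "V \<in> carrier_mat p p" "V * mat_adjoint V = 1\<^sub>m p" and X_eq: "X = Q * mat_adjoint V"
    and ij: "i < p" "p \<le> j" "j < n"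
  shows "e i \<le> e j"
proof -
  have orth: "col U k \<bullet>c col U l = (if k = l then 1 else 0)" if "k < n" "l < n" for k l
    using U(2) that unfolding orthonormal_cols_iff[OF U(1)] by auto
  have eig: "A *\<^sub>v col U k = complex_of_real (e k) \<cdot>\<^sub>v col U k" if "k < n" for k
    using AU that unfolding mult_mat_diag_iff[OF A U(1)] by blast
  have dimU: "dim_vec (col U k) = n" for k using U by simp
  have QQ: "mat_adjoint Q * Q = 1\<^sub>m p"
    unfolding orthonormal_cols_iff[OF Q] using ij orth by (auto simp: QU)
  have X: "X \<in> carrier_mat n p" using Q V by (auto simp: X_eq)
  have EX: "qOMM_energy A X = (\<Sum>k<p. e k)"
    unfolding X_eq qOMM_energy_frame[OF A Q QQ V] using ij
    by (intro sum.cong) (simp_all add: QU eigen_form[OF A U AU])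
  \<comment> \<open>The curve rotates only the i-th eigenvector and then applies the fixed factor
    V^*. Its points have orthonormal columns, so the frame formula gives their energy
    exactly.\<close>
  define u where "u = (\<lambda>t. complex_of_real (sqrt (1 - t\<^sup>2)) \<cdot>\<^sub>v col U i + complex_of_real t \<cdot>\<^sub>v col U j)"
  define R where "R = (\<lambda>t. mat n p (\<lambda>(a,k). if k = i then u t $ a else Q $$ (a,k)))"
  have u: "u t \<in> carrier_vec n" for t using U by (auto simp: u_def)
  have R: "R t \<in> carrier_mat n p" for t by (simp add: R_def)
  have colR: "col (R t) k = (if k = i then u t else col U k)" if "k < p" for t k
    using that u[of t] Q U QU[OF that, symmetric] by (intro eq_vecI) (auto simp: R_def)
  \<comment> \<open>The energy along the curve is exactly quadratic in t, hence \<open>K\<close> is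
    0. The constant 2 p comes from the entries of \<open>R t - Q\<close>, at most 2 t, summed over p
    terms in the product with V^*.\<close>
  have "0 \<le> e j - e i"
  proof (rule local_minimizer_curve[OF loc X, where k = 2 and Y = "\<lambda>t. R t * mat_adjoint V"
        and c = "2 * p" and K = 0])
    fix t :: real assume t: "0 < t" "t \<le> 1"
    have t2: "0 \<le> 1 - t\<^sup>2" using t by (simp add: power_le_one)
    then have sq: "(complex_of_real (sqrt (1 - t\<^sup>2)))\<^sup>2 = 1 - (complex_of_real t)\<^sup>2"
      by (simp flip: of_real_power)
    have uu: "u t \<bullet>c u t = 1"
      unfolding u_def by (rule unit_vec_combination) (use orth ij t2 in \<open>auto simp: dimU\<close>)
    have uU: "u t \<bullet>c col U k = 0" "col U k \<bullet>c u t = 0" if "k < p" "k \<noteq> i" for k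
      using orth that ij by (simp_all add: u_def cscalar_prod_linear dimU)
    have RR: "mat_adjoint (R t) * R t = 1\<^sub>m p"
      unfolding orthonormal_cols_iff[OF R]
      using orth uu uU ij by (auto simp: colR)
    show Y: "R t * mat_adjoint V \<in> carrier_mat n p" using R[of t] V(1) by auto
    show "R t * mat_adjoint V \<in> oblique n p"
      by (rule orthonormal_imp_oblique[OF Y frame_times_unitary[OF R RR V]])
    have VV: "mat_adjoint V * V = 1\<^sub>m p"
      by (rule mat_mult_left_right_inverse[OF V(1) mat_adjoint_carrier[OF V(1)] V(2)])
    have Vle: "cmod (V $$ (b,k)) \<le> 1" if "b < p" "k < p" for b k
      using oblique_entry_le[OF orthonormal_imp_oblique[OF V(1) VV] that] .
    have Ule: "cmod (U $$ (a,k)) \<le> 1" if "a < n" "k < n" for a k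
      using oblique_entry_le[OF orthonormal_imp_oblique[OF U] that] .
    have RQ: "cmod ((R t - Q) $$ (a,k)) \<le> 2 * t" if ak: "a < n" "k < p" for a k
    proof (cases "k = i")
      case True
      have Qi: "Q $$ (a,i) = U $$ (a,i)"
        using arg_cong[OF QU[of i], of "\<lambda>v. v $ a"] ak ij Q U by simp
      have "cmod ((R t - Q) $$ (a,k))
          = cmod (complex_of_real (sqrt (1 - t\<^sup>2) - 1) * U $$ (a,i) + complex_of_real t * U $$ (a,j))"
        using True ak ij Q U Qi by (simp add: R_def u_def algebra_simps)
      also have "\<dots> \<le> \<bar>sqrt (1 - t\<^sup>2) - 1\<bar> * cmod (U $$ (a,i)) + \<bar>t\<bar> * cmod (U $$ (a,j))"
        by (rule order_trans[OF norm_triangle_ineq]) (simp only: norm_mult norm_of_real order_refl)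
      also have "\<dots> \<le> t\<^sup>2 * 1 + t * 1"
        using t t2 ak ij by (intro add_mono mult_mono abs_sqrt_one_minus_le Ule) auto
      also have "\<dots> \<le> 2 * t" using t by (simp add: power2_eq_square mult_left_le_one_le)
      finally show ?thesis .
    next
      case False
      then show ?thesis using ak Q t by (simp add: R_def)
    qed
    show "cmod ((R t * mat_adjoint V) $$ (a,b) - X $$ (a,b)) \<le> real (2 * p) * t"
      if ab: "a < n" "b < p" for a b
    proof -
      have "R t * mat_adjoint V - X = (R t - Q) * mat_adjoint V"
        unfolding X_eq using R[of t] Q V(1) by (intro mat_distrib_dim(2)[symmetric]) auto
      then have "(R t * mat_adjoint V) $$ (a,b) - X $$ (a,b) = ((R t - Q) * mat_adjoint V) $$ (a,b)"
        using ab X Y by (metis carrier_matD index_minus_mat(1))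
      also have "cmod \<dots> \<le> real p * (2 * t * 1)"
        by (rule mult_adjoint_entry_bound[of _ n p _ p]) (use Q R V ab t RQ Vle in auto)
      finally show ?thesis by simp
    qed
    have Au: "Re ((A *\<^sub>v u t) \<bullet>c u t) = e i + t\<^sup>2 * (e j - e i)"
    proof -
      have "A *\<^sub>v u t = (complex_of_real (sqrt (1 - t\<^sup>2)) * complex_of_real (e i)) \<cdot>\<^sub>v col U i
          + (complex_of_real t * complex_of_real (e j)) \<cdot>\<^sub>v col U j"
        using A U ij eig[of i] eig[of j] unfolding u_def
        by (subst mult_add_distrib_mat_vec[of _ n n])
          (auto simp: mult_mat_vec[of _ n n] smult_smult_assoc)
      then have "(A *\<^sub>v u t) \<bullet>c u t = (complex_of_real (sqrt (1 - t\<^sup>2)))\<^sup>2 * complex_of_real (e i)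
          + (complex_of_real t)\<^sup>2 * complex_of_real (e j)"
        using orth ij by (simp add: u_def cscalar_prod_linear dimU power2_eq_square)
      also have "\<dots> = complex_of_real (e i + t\<^sup>2 * (e j - e i))"
        unfolding sq by (simp add: algebra_simps)
      finally show ?thesis by (metis Re_complex_of_real)
    qed
    have "qOMM_energy A (R t * mat_adjoint V) = (\<Sum>k<p. e k + (if k = i then t\<^sup>2 * (e j - e i) else 0))"
      unfolding qOMM_energy_frame[OF A R RR V] using ij
      by (intro sum.cong) (auto simp: colR Au eigen_form[OF A U AU])
    also have "\<dots> = qOMM_energy A X + t\<^sup>2 * (e j - e i)"
      using ij by (simp add: sum.distrib EX)
    finally show "qOMM_energy A (R t * mat_adjoint V) \<le> qOMM_energy A X + t\<^sup>2 * (e j - e i + 0 * t)"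
      by simp
  qed
  then show ?thesis by simp
qed

text \<open>On the invariant range of X, \<open>A\<close> acts through the Hermitian matrix X^* A X.
  Diagonalising it by V makes the columns of X V eigenvectors of \<open>A\<close>, and taking its
  eigenvalues in sorted order prepares the match of each column with its place in
  \<open>sorted_eigenvalues A\<close>.\<close>

lemma local_minimizer_smallest_eigenvectors:
  assumes A: "A \<in> carrier_mat n n" "negative_definite_mat A" and pn: "p \<le> n"
    and loc: "local_minimizer (qOMM_energy A) (oblique n p) X"
  obtains Q V where "smallest_eigenvectors A p Q" "V \<in> carrier_mat p p" "unitary_mat V"
    "X = Q * mat_adjoint V"
proof -
  have herm: "hermitian_mat A" by (rule negative_definite_imp_hermitian[OF A(2)])
  have X: "X \<in> carrier_mat n p" using loc by (simp add: local_minimizer_def oblique_iff)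
  note inv = local_minimizer_orthonormal_invariant[OF A pn loc]
  define L where "L = mat_adjoint X * A * X"
  have L: "L \<in> carrier_mat p p" using X A by (auto simp: L_def)
  have dims: "dim_row A = n" "dim_col A = n" "dim_row X = n" "dim_col X = p"
    "dim_row L = p" "dim_col L = p" using A X L by auto
  have "hermitian_mat L"
    by (rule hermitian_matI[OF L])
      (simp add: L_def mat_adjoint_mult_dim dims hermitian_mat_adjoint[OF herm] mult_mat_assoc_dim)
  then obtain V where V: "V \<in> carrier_mat p p" "mat_adjoint V * V = 1\<^sub>m p"
    "L * V = V * mat_diag p (\<lambda>i. complex_of_real (sorted_eigenvalues L ! i))"
    using hermitian_sorted_eigenbasis[OF L] by blast
  define \<mu> where "\<mu> = (\<lambda>i. sorted_eigenvalues L ! i)"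
  define Q where "Q = X * V"
  have VV: "V * mat_adjoint V = 1\<^sub>m p" by (rule unitary_rightI[OF V(1,2)])
  have Q: "Q \<in> carrier_mat n p" using X V by (auto simp: Q_def)
  have dimsV: "dim_row V = p" "dim_col V = p" using V by auto
  have QQ: "mat_adjoint Q * Q = 1\<^sub>m p"
    using frame_times_unitary[OF X inv(1), of "mat_adjoint V"] V by (simp add: Q_def)
  have "A * Q = (A * X) * V" by (simp add: Q_def mult_mat_assoc_dim dims dimsV)
  also have "\<dots> = X * (L * V)"
    by (subst inv(2), fold L_def) (simp add: mult_mat_assoc_dim dims dimsV)
  also have "\<dots> = Q * mat_diag p (\<lambda>i. complex_of_real (\<mu> i))"
    unfolding V(3) by (simp add: Q_def \<mu>_def mult_mat_assoc_dim dims dimsV)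
  finally have AQ: "A * Q = Q * mat_diag p (\<lambda>i. complex_of_real (\<mu> i))" .
  have X_eq: "X = Q * mat_adjoint V"
    using X VV by (simp add: Q_def mult_mat_assoc_dim dims dimsV)
  obtain U e where U: "U \<in> carrier_mat n n" "mat_adjoint U * U = 1\<^sub>m n"
    and AU: "A * U = U * mat_diag n (\<lambda>i. complex_of_real (e i))"
    and eU: "\<And>j. j < p \<Longrightarrow> e j = \<mu> j" "\<And>j. j < p \<Longrightarrow> col Q j = col U j"
    using hermitian_extend_eigenbasis[OF A(1) herm Q QQ AQ pn] by metis
  have le: "e i \<le> e j" if "i < p" "p \<le> j" "j < n" for i j
    by (rule local_minimizer_eigenvalue_le[OF A(1) loc U AU Q eU(2) V(1) VV X_eq that])
  \<comment> \<open>The values in the range are already sorted and none exceeds a value outside, so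
    sorting the whole list leaves the first p in place. A tie at the boundary is allowed by the weak
    inequality.\<close>
  have "sort (map e [0..<n]) = map e [0..<p] @ sort (map e [p..<n])"
  proof (rule properties_for_sort)
    show "mset (map e [0..<p] @ sort (map e [p..<n])) = mset (map e [0..<n])"
    proof -
      have "[0..<n] = [0..<p] @ [p..<n]" using pn upt_add_eq_append[of 0 p "n - p"] by simp
      then show ?thesis by (simp only: map_append mset_append mset_sort)
    qed
    have "sorted (map e [0..<p])"
    proof -
      have "map e [0..<p] = sorted_eigenvalues L"
        using length_sorted_eigenvalues[OF L] eU(1) by (intro nth_equalityI) (auto simp: \<mu>_def)
      then show ?thesis by (simp add: sorted_sorted_eigenvalues)
    qed
    then show "sorted (map e [0..<p] @ sort (map e [p..<n]))"
      using le by (auto simp: sorted_append)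
  qed
  then have ev: "sorted_eigenvalues A ! j = \<mu> j" if "j < p" for j
    using that eU(1) by (simp add: sorted_eigenvalues_eq_sort[OF A(1) U AU] nth_append)
  have "mat_diag p (\<lambda>j. complex_of_real (sorted_eigenvalues A ! j)) = mat_diag p (\<lambda>j. complex_of_real (\<mu> j))"
    using ev by (intro eq_matI) (auto simp: mat_diag_def)
  then have "smallest_eigenvectors A p Q"
    using A(1) Q QQ AQ by (simp add: smallest_eigenvectors_def)
  moreover have "unitary_mat V" using V VV by (simp add: unitary_mat_def square_mat.simps)
  ultimately show ?thesis using that V(1) X_eq by blast
qed

section \<open>The global lower bound\<close>

text \<open>Z Z^* and Z^* Z have the same Frobenius norm, for a matrix Z with rows in
  \<open>S\<close> and columns in \<open>T\<close>: both sides expand to the same fourfold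
  sum.\<close>

lemma gram_square_sum_swap:
  fixes Z :: "'a \<Rightarrow> 'b \<Rightarrow> complex"
  shows "(\<Sum>i\<in>S. \<Sum>k\<in>S. (cmod (\<Sum>j\<in>T. Z i j * cnj (Z k j)))\<^sup>2)
    = (\<Sum>j\<in>T. \<Sum>l\<in>T. (cmod (\<Sum>i\<in>S. Z i j * cnj (Z i l)))\<^sup>2)"
proof -
  have rot: "(\<Sum>k\<in>S. \<Sum>j\<in>T. \<Sum>l\<in>T. f k j l) = (\<Sum>j\<in>T. \<Sum>l\<in>T. \<Sum>k\<in>S. f k j l)"
    for f :: "'a \<Rightarrow> 'b \<Rightarrow> 'b \<Rightarrow> complex"
    by (subst sum.swap) (intro sum.cong refl, rule sum.swap)
  have "complex_of_real (\<Sum>i\<in>S. \<Sum>k\<in>S. (cmod (\<Sum>j\<in>T. Z i j * cnj (Z k j)))\<^sup>2)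
      = (\<Sum>i\<in>S. \<Sum>k\<in>S. \<Sum>j\<in>T. \<Sum>l\<in>T. Z i j * cnj (Z k j) * (cnj (Z i l) * Z k l))"
    by (simp add: complex_norm_square sum_product del: of_real_power)
  also have "\<dots> = (\<Sum>j\<in>T. \<Sum>l\<in>T. \<Sum>i\<in>S. \<Sum>k\<in>S. Z i j * cnj (Z k j) * (cnj (Z i l) * Z k l))"
    by (simp only: rot)
  also have "\<dots> = (\<Sum>j\<in>T. \<Sum>l\<in>T. \<Sum>i\<in>S. \<Sum>k\<in>S. (Z i j * cnj (Z i l)) * (cnj (Z k j) * Z k l))"
    by (simp add: mult_ac)
  also have "\<dots> = complex_of_real (\<Sum>j\<in>T. \<Sum>l\<in>T. (cmod (\<Sum>i\<in>S. Z i j * cnj (Z i l)))\<^sup>2)"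
    by (simp add: complex_norm_square sum_product del: of_real_power)
  finally show ?thesis using of_real_eq_iff by blast
qed

lemma double_minus_square_le_one: "2 * a - a\<^sup>2 \<le> (1 :: real)"
  using zero_le_power2[of "a - 1"] by (simp add: power2_eq_square algebra_simps)

lemma diag_square_le:
  fixes g :: "'a \<Rightarrow> complex"
  assumes "finite S" "i \<in> S"
  shows "(Re (g i))\<^sup>2 \<le> (\<Sum>k\<in>S. (cmod (g k))\<^sup>2)"
proof -
  have "(Re (g i))\<^sup>2 \<le> (cmod (g i))\<^sup>2" by (simp add: cmod_power2)
  also have "\<dots> \<le> (\<Sum>k\<in>S. (cmod (g k))\<^sup>2)"
    by (rule member_le_sum) (use assms in auto)
  finally show ?thesis .
qed

text \<open>Passing from the rows in \<open>S\<close> to the p columns keeps the trace and the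
  Frobenius norm of the Gram matrix, and each column contributes at most 2 a - a^2 \<le> 1. The
  bound is therefore p, whatever the size of \<open>S\<close>.\<close>

lemma gram_partial_trace_le:
  fixes Z :: "'a \<Rightarrow> nat \<Rightarrow> complex" and p :: nat
  assumes "finite S"
  defines "g \<equiv> \<lambda>i k. \<Sum>j<p. Z i j * cnj (Z k j)"
  shows "(\<Sum>i\<in>S. 2 * Re (g i i) - (\<Sum>k\<in>S. (cmod (g i k))\<^sup>2)) \<le> real p"
proof -
  define h where "h = (\<lambda>j l. \<Sum>i\<in>S. Z i j * cnj (Z i l))"
  have "(\<Sum>i\<in>S. Re (g i i)) = (\<Sum>j<p. Re (h j j))"
    unfolding g_def h_def Re_sum by (rule sum.swap)
  moreover have "(\<Sum>i\<in>S. \<Sum>k\<in>S. (cmod (g i k))\<^sup>2) = (\<Sum>j<p. \<Sum>l<p. (cmod (h j l))\<^sup>2)"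
    unfolding g_def h_def by (rule gram_square_sum_swap)
  ultimately have "(\<Sum>i\<in>S. 2 * Re (g i i) - (\<Sum>k\<in>S. (cmod (g i k))\<^sup>2))
      = (\<Sum>j<p. 2 * Re (h j j) - (\<Sum>l<p. (cmod (h j l))\<^sup>2))"
    by (simp add: sum_subtractf flip: sum_distrib_left)
  also have "\<dots> \<le> (\<Sum>j<p. 1)"
  proof (rule sum_mono)
    fix j assume "j \<in> {..<p}"
    then show "2 * Re (h j j) - (\<Sum>l<p. (cmod (h j l))\<^sup>2) \<le> 1"
      using diag_square_le[of "{..<p}" j "h j"] double_minus_square_le_one[of "Re (h j j)"] by simp
  qed
  finally show ?thesis by simp
qed

text \<open>The weights act as a fractional choice of p indices. Since every value is nonpositive,
  clipping negative weights to 0 can only lower the sum, and weights in [0,1] of total at most p do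
  best on the p smallest values.\<close>

lemma sum_smallest_le_weighted_sum:
  fixes l t :: "nat \<Rightarrow> real"
  assumes p: "0 < p" "p \<le> n" and mono: "\<And>i j. i \<le> j \<Longrightarrow> j < n \<Longrightarrow> l i \<le> l j"
    and neg: "\<And>i. i < n \<Longrightarrow> l i \<le> 0" and t1: "\<And>i. i < n \<Longrightarrow> t i \<le> 1"
    and tS: "\<And>S. S \<subseteq> {..<n} \<Longrightarrow> (\<Sum>i\<in>S. t i) \<le> real p"
  shows "(\<Sum>i<p. l i) \<le> (\<Sum>i<n. l i * t i)"
proof -
  define c where "c = (\<lambda>i. max (t i) 0)"
  \<comment> \<open>Indices start at 0, so this is the p-th smallest value. After subtracting it the
    first p values are nonpositive and the others nonnegative, so each index can be compared on its
    own; \<theta> \<le> 0 takes care of a total weight below p.\<close>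
  define \<theta> where "\<theta> = l (p - 1)"
  have \<theta>: "\<theta> \<le> 0" using neg p by (simp add: \<theta>_def)
  have c: "0 \<le> c i" "t i \<le> c i" "i < n \<Longrightarrow> c i \<le> 1" for i using t1 by (auto simp: c_def)
  \<comment> \<open>The clipped total is the sum over the indices of nonnegative weight; this is why
    \<open>tS\<close> speaks of subsets.\<close>
  have "(\<Sum>i<n. c i) = (\<Sum>i\<in>{i\<in>{..<n}. 0 \<le> t i}. t i)"
    by (subst sum.inter_filter) (auto simp: c_def intro!: sum.cong)
  then have sc: "(\<Sum>i<n. c i) \<le> real p" using tS[of "{i\<in>{..<n}. 0 \<le> t i}"] by auto
  have "(\<Sum>i<p. l i) = (\<Sum>i<n. if i < p then l i - \<theta> else 0) + \<theta> * real p"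
  proof -
    have "(\<Sum>i<n. if i < p then l i - \<theta> else 0) = (\<Sum>i<p. l i - \<theta>)"
      using p by (intro sum.mono_neutral_cong_right) auto
    then show ?thesis by (simp add: sum_subtractf mult.commute)
  qed
  also have "\<dots> \<le> (\<Sum>i<n. (l i - \<theta>) * c i) + \<theta> * (\<Sum>i<n. c i)"
  proof (rule add_mono)
    show "(\<Sum>i<n. if i < p then l i - \<theta> else 0) \<le> (\<Sum>i<n. (l i - \<theta>) * c i)"
    proof (rule sum_mono)
      fix i assume "i \<in> {..<n}"
      then have i: "i < n" by simp
      show "(if i < p then l i - \<theta> else 0) \<le> (l i - \<theta>) * c i"
      proof (cases "i < p")
        case True
        then have "l i \<le> \<theta>" using mono[of i "p - 1"] p by (simp add: \<theta>_def)
        then have "(l i - \<theta>) * 1 \<le> (l i - \<theta>) * c i"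
          using c(3)[OF i] by (intro mult_left_mono_neg) auto
        then show ?thesis using True by simp
      next
        case False
        then have "\<theta> \<le> l i" using mono[of "p - 1" i] i by (simp add: \<theta>_def)
        then show ?thesis using False c(1)[of i] by simp
      qed
    qed
    show "\<theta> * real p \<le> \<theta> * (\<Sum>i<n. c i)" using sc \<theta> by (rule mult_left_mono_neg)
  qed
  also have "\<dots> = (\<Sum>i<n. l i * c i)"
    by (simp add: sum_distrib_left sum.distrib[symmetric] algebra_simps)
  also have "\<dots> \<le> (\<Sum>i<n. l i * t i)"
    using c(2) neg by (intro sum_mono mult_left_mono_neg) auto
  finally show ?thesis .
qed

text \<open>In an eigenbasis of \<open>A\<close> the trace against the diagonal matrix sees only the
  diagonal of 2 g - g^2, where g = Z Z^* is Y Y^* in the new basis. Since g is Hermitian, these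
  entries are the real weights \<open>t\<close>.\<close>

lemma sum_smallest_eigenvalues_le_qOMM_energy:
  assumes A: "A \<in> carrier_mat n n" "negative_definite_mat A" and p: "1 \<le> p" "p \<le> n"
    and Y: "Y \<in> carrier_mat n p"
  shows "(\<Sum>i<p. sorted_eigenvalues A ! i) \<le> qOMM_energy A Y"
proof -
  have herm: "hermitian_mat A" by (rule negative_definite_imp_hermitian[OF A(2)])
  define l where "l = (\<lambda>i. sorted_eigenvalues A ! i)"
  obtain U where U: "U \<in> carrier_mat n n" "mat_adjoint U * U = 1\<^sub>m n"
    and AU: "A * U = U * mat_diag n (\<lambda>i. complex_of_real (l i))"
    using hermitian_sorted_eigenbasis[OF A(1) herm] unfolding l_def by blast
  have UU: "U * mat_adjoint U = 1\<^sub>m n" by (rule unitary_rightI[OF U])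
  define Z where "Z = mat_adjoint U * Y"
  define G where "G = Y * mat_adjoint Y"
  define g where "g = mat_adjoint U * G * U"
  define D where "D = mat_diag n (\<lambda>i. complex_of_real (l i))"
  have dims: "dim_row A = n" "dim_col A = n" "dim_row U = n" "dim_col U = n"
    "dim_row Y = n" "dim_col Y = p" "dim_row Z = n" "dim_col Z = p" "dim_row G = n" "dim_col G = n"
    "dim_row g = n" "dim_col g = n" "dim_row D = n" "dim_col D = n"
    using A U Y by (auto simp: Z_def G_def g_def D_def)
  have UUB: "U * (mat_adjoint U * B) = B" if "dim_row B = n" for B
    using UU that by (subst mult_mat_assoc_dim[symmetric]) (auto simp: dims)
  have g_eq: "g = Z * mat_adjoint Z"
    by (simp add: g_def Z_def G_def mat_adjoint_mult_dim mult_mat_assoc_dim dims)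
  have g_index: "g $$ (i,k) = (\<Sum>j<p. Z $$ (i,j) * cnj (Z $$ (k,j)))" if "i < n" "k < n" for i k
    unfolding g_eq using that by (simp add: scalar_prod_def atLeast0LessThan dims)
  have g_adj: "g $$ (k,i) = cnj (g $$ (i,k))" if "i < n" "k < n" for i k
    using that by (simp add: g_index mult.commute)
  have gg: "mat_adjoint U * (G * G) * U = g * g"
    unfolding g_def by (simp add: mult_mat_assoc_dim dims UUB)
  define t where "t = (\<lambda>i. 2 * Re (g $$ (i,i)) - (\<Sum>k<n. (cmod (g $$ (i,k)))\<^sup>2))"
  have "A = U * D * mat_adjoint U"
  proof -
    have "A = A * (U * mat_adjoint U)" using A(1) by (simp add: UU)
    also have "\<dots> = A * U * mat_adjoint U" by (simp add: mult_mat_assoc_dim dims)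
    finally show ?thesis unfolding AU D_def .
  qed
  then have "mat_trace (A * (2 \<cdot>\<^sub>m G - G * G)) = mat_trace (U * (D * (mat_adjoint U * (2 \<cdot>\<^sub>m G - G * G))))"
    by (simp add: mult_mat_assoc_dim dims)
  also have "\<dots> = mat_trace ((D * (mat_adjoint U * (2 \<cdot>\<^sub>m G - G * G))) * U)"
    by (rule mat_trace_comm_dim) (simp_all add: dims)
  also have "(D * (mat_adjoint U * (2 \<cdot>\<^sub>m G - G * G))) * U
      = D * (2 \<cdot>\<^sub>m g - mat_adjoint U * (G * G) * U)"
    unfolding g_def by (simp add: mult_mat_assoc_dim mat_distrib_dim smult_mult_dim dims)
  also have "mat_trace (D * (2 \<cdot>\<^sub>m g - mat_adjoint U * (G * G) * U))
      = (\<Sum>i<n. complex_of_real (l i) * (2 * g $$ (i,i) - (g * g) $$ (i,i)))"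
    unfolding gg
    by (simp add: mat_trace_def D_def mat_diag_mult_left[of _ n n] carrier_matI dims
        del: index_mult_mat(1))
  also have "\<dots> = (\<Sum>i<n. complex_of_real (l i) * (2 * g $$ (i,i)
      - complex_of_real (\<Sum>k<n. (cmod (g $$ (i,k)))\<^sup>2)))"
  proof (rule sum.cong)
    fix i assume "i \<in> {..<n}"
    then have i: "i < n" by simp
    have "(g * g) $$ (i,i) = (\<Sum>k<n. g $$ (i,k) * cnj (g $$ (i,k)))"
      using i g_adj[OF i] by (simp add: scalar_prod_def atLeast0LessThan dims)
    also have "\<dots> = complex_of_real (\<Sum>k<n. (cmod (g $$ (i,k)))\<^sup>2)"
      by (simp add: complex_norm_square del: of_real_power)
    finally show "complex_of_real (l i) * (2 * g $$ (i,i) - (g * g) $$ (i,i))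
      = complex_of_real (l i) * (2 * g $$ (i,i) - complex_of_real (\<Sum>k<n. (cmod (g $$ (i,k)))\<^sup>2))"
      by simp
  qed simp
  finally have "qOMM_energy A Y = (\<Sum>i<n. l i * t i)"
    unfolding qOMM_energy_eq[OF A(1) Y] G_def[symmetric] t_def by simp
  moreover have "(\<Sum>i<p. l i) \<le> (\<Sum>i<n. l i * t i)"
  proof (rule sum_smallest_le_weighted_sum)
    show "0 < p" "p \<le> n" using p by auto
    show "l i \<le> l j" if "i \<le> j" "j < n" for i j
      using that sorted_sorted_eigenvalues[of A] length_sorted_eigenvalues[OF A(1)]
      by (simp add: l_def sorted_nth_mono)
    show "l i \<le> 0" if i: "i < n" for i
    proof -
      have "col U i \<bullet>c col U i = 1"
        using U(2) i unfolding orthonormal_cols_iff[OF U(1)] by simp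
      then have "col U i \<noteq> 0\<^sub>v n" by auto
      moreover have "col U i \<in> carrier_vec n" using U i by simp
      ultimately have "Re ((A *\<^sub>v col U i) \<bullet>c col U i) < 0"
        using A by (auto simp: negative_definite_mat_def)
      then show ?thesis using eigen_form[OF A(1) U AU i] by simp
    qed
    show "t i \<le> 1" if "i < n" for i
      using diag_square_le[of "{..<n}" i "\<lambda>k. g $$ (i,k)"] that
        double_minus_square_le_one[of "Re (g $$ (i,i))"] by (simp add: t_def)
    show "(\<Sum>i\<in>S. t i) \<le> real p" if S: "S \<subseteq> {..<n}" for S
    proof -
      have fin: "finite S" using S finite_subset by blast
      \<comment> \<open>Dropping the subtracted squares with k outside \<open>S\<close> only
        increases the sum and leaves the Gram matrix of the rows in \<open>S\<close>.\<close>
      have "(\<Sum>i\<in>S. t i) \<le> (\<Sum>i\<in>S. 2 * Re (g $$ (i,i)) - (\<Sum>k\<in>S. (cmod (g $$ (i,k)))\<^sup>2))"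
        unfolding t_def by (intro sum_mono diff_left_mono sum_mono2) (use S in auto)
      also have "\<dots> = (\<Sum>i\<in>S. 2 * Re (\<Sum>j<p. Z $$ (i,j) * cnj (Z $$ (i,j)))
          - (\<Sum>k\<in>S. (cmod (\<Sum>j<p. Z $$ (i,j) * cnj (Z $$ (k,j))))\<^sup>2))"
        using S by (intro sum.cong arg_cong2[where f = "(-)"]) (auto simp: g_index subset_iff)
      also have "\<dots> \<le> real p"
        using gram_partial_trace_le[OF fin, where p = p and Z = "\<lambda>i j. Z $$ (i,j)"] .
      finally show ?thesis .
    qed
  qed
  ultimately show ?thesis by (simp add: l_def)
qed

theorem theorem2p3:
  fixes A :: "complex mat" and n p :: nat
  assumes "1 \<le> p" and "p \<le> n"
    and "A \<in> carrier_mat n n"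
    and "negative_definite_mat A"
  shows "(\<forall>X. local_minimizer (qOMM_energy A) (oblique n p) X \<longrightarrow>
            (\<exists>Q V. smallest_eigenvectors A p Q \<and> V \<in> carrier_mat p p \<and> unitary_mat V \<and>
                   X = Q * mat_adjoint V))
       \<and> (\<forall>Q V. smallest_eigenvectors A p Q \<longrightarrow> V \<in> carrier_mat p p \<longrightarrow> unitary_mat V \<longrightarrow>
            local_minimizer (qOMM_energy A) (oblique n p) (Q * mat_adjoint V))
       \<and> (\<forall>X. local_minimizer (qOMM_energy A) (oblique n p) X \<longrightarrow>
            global_minimizer (qOMM_energy A) (oblique n p) X)"
proof -
  note A = assms(3,4)
  \<comment> \<open>Global minimality of Q V^* settles both remaining claims: it implies local
    minimality, and every local minimizer has this form.\<close>
  have global: "global_minimizer (qOMM_energy A) (oblique n p) (Q * mat_adjoint V)"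
    if Q: "smallest_eigenvectors A p Q" and V: "V \<in> carrier_mat p p" "unitary_mat V" for Q V
  proof -
    have Q': "Q \<in> carrier_mat n p" "mat_adjoint Q * Q = 1\<^sub>m p"
      "A * Q = Q * mat_diag p (\<lambda>j. complex_of_real (sorted_eigenvalues A ! j))"
      using Q A(1) by (auto simp: smallest_eigenvectors_def)
    have VV: "V * mat_adjoint V = 1\<^sub>m p" using V by (auto simp: unitary_mat_def)
    have "Q * mat_adjoint V \<in> carrier_mat n p" using Q' V by auto
    then have "Q * mat_adjoint V \<in> oblique n p"
      by (rule orthonormal_imp_oblique[OF _ frame_times_unitary[OF Q'(1,2) V(1) VV]])
    moreover have "qOMM_energy A (Q * mat_adjoint V) = (\<Sum>i<p. sorted_eigenvalues A ! i)"
      unfolding qOMM_energy_frame[OF A(1) Q'(1,2) V(1) VV]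
      by (intro sum.cong) (simp_all add: eigen_form[OF A(1) Q'])
    ultimately show ?thesis
      using sum_smallest_eigenvalues_le_qOMM_energy[OF A assms(1,2)]
      by (auto simp: global_minimizer_def oblique_def)
  qed
  have local: "local_minimizer (qOMM_energy A) (oblique n p) X"
    if "global_minimizer (qOMM_energy A) (oblique n p) X" for X
    using that by (auto simp: global_minimizer_def local_minimizer_def intro: exI[of _ 1])
  show ?thesis
    using local_minimizer_smallest_eigenvectors[OF A assms(2)] global local by metis
qed

end
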